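(* Let $\ell \ge r\ge 2$ be integers. For every $\delta>0$ there exist $\epsilon > 0$ and $n_0$ such that the following holds for all real numbers $x\ge n_0$. Suppose that $\mathcal{H}$ is a $\mathcal{K}_{\ell+1}^{r}$-free $r$-graph with $$|\partial\mathcal{H}| = \binom{\ell}{r-1}\left(\frac{x}{\ell}\right)^{r-1} \quad\text{and}\quad |\mathcal{H}| \ge (1-\epsilon)\binom{\ell}{r}\left(\frac{x}{\ell}\right)^{r}.$$ Then there exists a set $V'\subset V(\mathcal{H})$ of size at most $\lceil x \rceil$ such that $\mathcal{H}$ is a subgraph of a complete $\ell$-partite $r$-graph on $V'$ after removing at most $\delta x^r$ edges.
   Context: An $r$-uniform hypergraph ($r$-graph) $\mathcal{H}$ is a collection of $r$-element subsets (edges) of a finite ground set $V(\mathcal{H})$ (the vertex set); $\mathcal{H}$ is identified with its edge set, so $|\mathcal{H}|$ is the number of edges. The shadow of $\mathcal{H}$ is the $(r-1)$-graph $\partial\mathcal{H}$ consisting of all $(r-1)$-subsets $A$ of $V(\mathcal{H})$ for which there is $B\in\mathcal{H}$ with $A\subset B$. For $\ell\ge r\ge 2$, $\mathcal{K}_{\ell+1}^{r}$ denotes the family of all $r$-graphs $F$ with at most $\binom{\ell+1}{2}$ edges such that for some $(\ell+1)$-element set $S$ of vertices of $F$, every pair $\{u,v\}\subset S$ is contained in an edge of $F$. For a family $\mathcal{F}$ of $r$-graphs, an $r$-graph is $\mathcal{F}$-free if it does not contain any member of $\mathcal{F}$ as a (not necessarily induced) subgraph. A complete $\ell$-partite $r$-graph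 on $V'$ is the collection of all $r$-subsets of $V'$ having at most one vertex in each part of some partition $V'=V_1\cup\cdots\cup V_\ell$. The conclusion means that one can delete at most $\delta x^r$ edges from $\mathcal{H}$ so that every remaining edge is an edge of such a complete $\ell$-partite $r$-graph on $V'$ (in particular is contained in $V'$). *)

theory Defs
  imports Complex_Main "HOL-Library.Disjoint_Sets"
begin

record 'a hypergraph =
  verts :: "'a set"
  edges :: "'a set set"

definition r_graph :: "nat \<Rightarrow> 'a hypergraph \<Rightarrow> bool" where
  "r_graph r H \<longleftrightarrow> finite (verts H) \<and> (\<forall>e \<in> edges H. e \<subseteq> verts H \<and> card e = r)"

definition shadow :: "nat \<Rightarrow> 'a hypergraph \<Rightarrow> 'a hypergraph" where
  "shadow r H =
     \<lparr>verts = verts H,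
      edges = {A. A \<subseteq> verts H \<and> card A = r - 1 \<and> (\<exists>B \<in> edges H. A \<subset> B)}\<rparr>"

text \<open>\<open>F\<close> is contained in \<open>H\<close> as a subgraph that need not be induced, up to renaming vertices;
  \<open>F\<close> and \<open>H\<close> may live on different vertex types.\<close>

definition contains_copy :: "'a hypergraph \<Rightarrow> 'b hypergraph \<Rightarrow> bool" where
  "contains_copy H F \<longleftrightarrow>
     (\<exists>f. inj_on f (verts F) \<and> f ` verts F \<subseteq> verts H \<and> (\<forall>e \<in> edges F. f ` e \<in> edges H))"

definition family_free :: "'b hypergraph set \<Rightarrow> 'a hypergraph \<Rightarrow> bool" where
  "family_free \<F> H \<longleftrightarrow> (\<forall>F \<in> \<F>. \<not> contains_copy H F)"

text \<open>\<open>K_family r k\<close> is the family $\mathcal{K}_k^r$. Its members are taken on vertex sets of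
  natural numbers, which represents every finite \<open>r\<close>-graph up to isomorphism. In particular the
  family does not depend on the vertex type of the hypergraph that is required to avoid it.\<close>

definition K_family :: "nat \<Rightarrow> nat \<Rightarrow> nat hypergraph set" where
  "K_family r k =
     {F. r_graph r F \<and> card (edges F) \<le> k choose 2 \<and>
         (\<exists>S \<subseteq> verts F. card S = k \<and>
            (\<forall>u \<in> S. \<forall>v \<in> S. u \<noteq> v \<longrightarrow> (\<exists>e \<in> edges F. {u, v} \<subseteq> e)))}"

text \<open>As usual for \<open>l\<close>-partite hypergraphs, parts of the partition may be empty; for this reason
  the parts form an indexed family and \<open>partition_on\<close> is not used.\<close>

definition complete_partite :: "nat \<Rightarrow> nat \<Rightarrow> 'a set \<Rightarrow> 'a hypergraph \<Rightarrow> bool" where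
  "complete_partite r l V' K \<longleftrightarrow>
     (\<exists>W :: nat \<Rightarrow> 'a set.
        disjoint_family_on W {1..l} \<and> (\<Union>i \<in> {1..l}. W i) = V' \<and>
        K = \<lparr>verts = V',
             edges = {e. e \<subseteq> V' \<and> card e = r \<and> (\<forall>i \<in> {1..l}. card (e \<inter> W i) \<le> 1)}\<rparr>)"

end

theory Submission
  imports Defs "HOL-Analysis.Convex"
begin

text \<open>
  Write \<open>d(A)\<close> for the number of edges containing \<open>A\<close>. Being free of the family means that no
  \<open>l + 1\<close> vertices are pairwise covered by edges; hence for \<open>card C = k \<le> r - 2\<close> the graph
  of pairs \<open>{y, z}\<close> such that \<open>C \<union> {y, z}\<close> lies in an edge has no clique on
  \<open>l - k + 1\<close> vertices.

  Compare \<open>d(A)\<close> with the value \<open>model (card A)\<close> that it takes in the balanced complete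
  \<open>l\<close>-partite hypergraph on \<open>x\<close> vertices, let \<open>g(A)\<close> be the quotient, and let \<open>a k\<close> be
  the average of \<open>ln (g A)\<close> over all pairs of an edge and a \<open>k\<close>-subset \<open>A\<close> of it.
  The weighted Turan (Motzkin-Straus) inequality in the link of \<open>C\<close>, with weights
  \<open>d(C \<union> {y})\<close>, says that
  \<open>g(C \<union> {y}) * g(C \<union> {z}) / (g(C \<union> {y, z}) * g(C))\<close> has average at most 1
  over all edges and all \<open>C, y, z\<close> inside them. By Jensen's inequality for the logarithm the
  sequence \<open>a\<close> is convex. (In the language of entropy: the mutual information of two further random
  vertices of a random edge, given \<open>k\<close> of its vertices, is at least
  \<open>ln ((l - k) / (l - k - 1))\<close>.) The prescribed shadow size says that
  \<open>g({}) / g(A)\<close> has average 1 over the \<open>(r - 1)\<close>-subsets of edges, so \<open>a (r - 1) \<ge> a 0\<close>;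
  and \<open>a r = 0\<close>. A convex sequence with these properties has \<open>a 0 \<le> 0\<close>, which is the upper bound
  \<open>g({}) \<le> 1\<close> on the number of edges.

  For stability, the hypothesis \<open>g({}) \<ge> 1 - \<epsilon>\<close> makes \<open>a 0\<close> almost 0, so every inequality above is
  almost tight (\<open>total_slack\<close>). Since \<open>(sqrt u - 1)\<^sup>2 \<le> u - 1 - ln u\<close>, almost tightness bounds
  the mean square distance of the ratios from 1, and all but a small proportion of the edges have all
  their ratios close to 1 (\<open>irregular_edges_le\<close>). In such a regular edge \<open>g\<close> is
  close to 1 on all subsets: it is 1 on the edge itself and close to \<open>g({})\<close> on subsets of size
  \<open>r - 1\<close>, and the ratios then carry the estimate downwards in size (\<open>abs_ln_rel_codegree_le\<close>).

  Let \<open>U\<close> be the set of vertices in regular edges (\<open>near_partite\<close>). All degrees in \<open>U\<close> are at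
  least about \<open>model 1\<close>, so \<open>U\<close> has at most about \<open>x\<close> vertices. Pairs in regular edges have
  codegree about \<open>model 2\<close>, so they number at least about \<open>(1 - 1 / l) * x\<^sup>2 / 2\<close>, almost
  the Turan bound for \<open>U\<close>. Fueredi's stability argument (\<open>coloring_of_clique_free_relation\<close>)
  colours \<open>U\<close> with \<open>l\<close> colours so that few of these pairs are monochromatic. Deleting the irregular edges,
  the edges through monochromatic pairs, and the edges through the few vertices of \<open>U\<close> in excess of
  \<open>\<lceil>x\<rceil>\<close> gives the claim. All errors are relative, so \<open>n\<^sub>0 = 1\<close> suffices.
\<close>

section \<open>Weighted Turan theorem with stability\<close>

text \<open>
  Fueredi's argument with vertex weights. Let \<open>x1\<close> have the largest weighted degree, let \<open>N\<close> be its
  neighbourhood, and make the rest \<open>B\<close> one colour class. The degrees of the vertices in \<open>B\<close> count the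
  pairs inside \<open>B\<close> twice and the pairs between \<open>B\<close> and \<open>N\<close> once, and each of them is at most the
  weight of \<open>N\<close>; and \<open>N\<close> contains no clique on \<open>p\<close> vertices, so induction applies to it.
  The monochromatic term on the left is what yields stability; all sums run over ordered pairs.
\<close>

lemma coloring_of_clique_free_relation:
  fixes w :: "'a \<Rightarrow> real" and R :: "'a \<Rightarrow> 'a \<Rightarrow> bool"
  assumes "finite V" and "\<And>v. v \<in> V \<Longrightarrow> 0 \<le> w v"
    and "\<And>u v. R u v \<Longrightarrow> R v u"
    and "\<And>S. S \<subseteq> V \<Longrightarrow> card S = Suc p \<Longrightarrow> \<exists>u\<in>S. \<exists>v\<in>S. u \<noteq> v \<and> \<not> R u v"
    and "\<And>v. \<not> R v v"
  shows "\<exists>f :: 'a \<Rightarrow> nat. f ` V \<subseteq> {1..p} \<and>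
    (\<Sum>x\<in>V. \<Sum>y\<in>V. of_bool (R x y) * w x * w y)
      + (\<Sum>x\<in>V. \<Sum>y\<in>V. of_bool (R x y \<and> f x = f y) * w x * w y)
      \<le> (\<Sum>x\<in>V. \<Sum>y\<in>V. of_bool (f x \<noteq> f y) * w x * w y)"
  using assms(1,2,4)
proof (induction p arbitrary: V)
  case 0
  have "V = {}"
  proof (rule ccontr)
    assume "V \<noteq> {}"
    then obtain v where "v \<in> V" by blast
    then show False using "0.prems"(3)[of "{v}"] by auto
  qed
  then show ?case by simp
next
  case (Suc p)
  show ?case
  proof (cases "V = {}")
    case True then show ?thesis by simp
  next
    case False
    define deg where "deg x = (\<Sum>y\<in>V. of_bool (R x y) * w y)" for x
    obtain x1 where x1: "x1 \<in> V" "\<And>x. x \<in> V \<Longrightarrow> deg x \<le> deg x1"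
    proof -
      have "finite (deg ` V)" "deg ` V \<noteq> {}" using Suc.prems(1) False by auto
      then have "Max (deg ` V) \<in> deg ` V" by (rule Max_in)
      then obtain x1 where "x1 \<in> V" "deg x1 = Max (deg ` V)" by auto
      then show ?thesis using that Max_ge[OF \<open>finite (deg ` V)\<close>] by force
    qed
    define N where "N = {y \<in> V. R x1 y}"
    define B where "B = V - N"
    have finN: "finite N" and finB: "finite B" and V: "V = B \<union> N" and dj: "B \<inter> N = {}"
      and NV: "N \<subseteq> V" and BV: "B \<subseteq> V"
      using Suc.prems(1) by (auto simp: N_def B_def)
    have "\<exists>u\<in>S. \<exists>v\<in>S. u \<noteq> v \<and> \<not> R u v" if S: "S \<subseteq> N" "card S = Suc p" for S
    proof -
      have "x1 \<notin> S" using S assms(5) by (auto simp: N_def)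
      moreover have "finite S" using S finN finite_subset by blast
      ultimately have "card (insert x1 S) = Suc (Suc p)" using S by simp
      moreover have "insert x1 S \<subseteq> V" using S x1 NV by auto
      ultimately obtain u v where "u \<in> insert x1 S" "v \<in> insert x1 S" "u \<noteq> v" "\<not> R u v"
        using Suc.prems(3) by blast
      moreover have "\<And>v. v \<in> S \<Longrightarrow> R x1 v" using S by (auto simp: N_def)
      ultimately show ?thesis using assms(3) by blast
    qed
    then obtain f where f: "f ` N \<subseteq> {1..p}" and IH:
      "(\<Sum>x\<in>N. \<Sum>y\<in>N. of_bool (R x y) * w x * w y)
      + (\<Sum>x\<in>N. \<Sum>y\<in>N. of_bool (R x y \<and> f x = f y) * w x * w y)
      \<le> (\<Sum>x\<in>N. \<Sum>y\<in>N. of_bool (f x \<noteq> f y) * w x * w y)"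
      using Suc.IH[OF finN] Suc.prems(2) NV by blast
    define f' where "f' v = (if v \<in> N then f v else Suc p)" for v
    have split: "(\<Sum>x\<in>V. \<Sum>y\<in>V. h x y) =
      (\<Sum>x\<in>N. \<Sum>y\<in>N. h x y) + (\<Sum>x\<in>B. \<Sum>y\<in>N. h x y) + (\<Sum>x\<in>N. \<Sum>y\<in>B. h x y)
      + (\<Sum>x\<in>B. \<Sum>y\<in>B. h x y)" for h :: "'a \<Rightarrow> 'a \<Rightarrow> real"
      unfolding V using finN finB dj by (simp add: sum.union_disjoint sum.distrib)
    have fN: "f' x = f x" if "x \<in> N" for x using that by (simp add: f'_def)
    have fB: "f' x = Suc p" if "x \<in> B" for x using that dj by (auto simp: f'_def)
    have ne: "f x \<noteq> Suc p" if "x \<in> N" for x using f that by fastforce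
    have range: "f' ` V \<subseteq> {1..Suc p}"
    proof
      fix i assume "i \<in> f' ` V"
      then obtain v where "v \<in> V" "i = f' v" by blast
      then show "i \<in> {1..Suc p}" using f by (cases "v \<in> N") (fastforce simp: f'_def)+
    qed
    have BN: "(\<Sum>x\<in>N. \<Sum>y\<in>B. of_bool (R x y) * w x * w y) =
        (\<Sum>x\<in>B. \<Sum>y\<in>N. of_bool (R x y) * w x * w y)"
      by (subst sum.swap) (use assms(3) in \<open>intro sum.cong refl; auto simp: mult_ac\<close>)
    have key: "(\<Sum>x\<in>B. \<Sum>y\<in>N. of_bool (R x y) * w x * w y) +
        (\<Sum>x\<in>B. \<Sum>y\<in>B. of_bool (R x y) * w x * w y) \<le> sum w B * sum w N"
    proof -
      have "(\<Sum>x\<in>B. \<Sum>y\<in>N. of_bool (R x y) * w x * w y) +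
        (\<Sum>x\<in>B. \<Sum>y\<in>B. of_bool (R x y) * w x * w y) = (\<Sum>x\<in>B. w x * deg x)"
        unfolding deg_def V sum.union_disjoint[OF finB finN dj] distrib_left sum.distrib
        unfolding sum_distrib_left by (simp only: mult_ac add_ac)
      also have "\<dots> \<le> (\<Sum>x\<in>B. w x * deg x1)"
        by (intro sum_mono mult_left_mono x1 Suc.prems(2)) (use BV in auto)
      also have "deg x1 = sum w N"
        unfolding deg_def N_def sum.inter_filter[OF Suc.prems(1)]
        by (rule sum.cong) auto
      finally show ?thesis by (simp add: sum_distrib_right)
    qed
    have A1: "(\<Sum>x\<in>V. \<Sum>y\<in>V. of_bool (R x y) * w x * w y) =
      (\<Sum>x\<in>N. \<Sum>y\<in>N. of_bool (R x y) * w x * w y)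
      + 2 * (\<Sum>x\<in>B. \<Sum>y\<in>N. of_bool (R x y) * w x * w y)
      + (\<Sum>x\<in>B. \<Sum>y\<in>B. of_bool (R x y) * w x * w y)"
      unfolding split BN by simp
    have A2: "(\<Sum>x\<in>V. \<Sum>y\<in>V. of_bool (R x y \<and> f' x = f' y) * w x * w y) =
      (\<Sum>x\<in>N. \<Sum>y\<in>N. of_bool (R x y \<and> f x = f y) * w x * w y)
      + (\<Sum>x\<in>B. \<Sum>y\<in>B. of_bool (R x y) * w x * w y)"
      unfolding split using ne by (simp add: fN fB cong: sum.cong) (auto intro!: sum.neutral dest: ne[symmetric] simp: fN fB)
    have A3: "(\<Sum>x\<in>V. \<Sum>y\<in>V. of_bool (f' x \<noteq> f' y) * w x * w y) =
      (\<Sum>x\<in>N. \<Sum>y\<in>N. of_bool (f x \<noteq> f y) * w x * w y) + 2 * (sum w B * sum w N)"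
    proof -
      have "(\<Sum>x\<in>B. \<Sum>y\<in>N. of_bool (f' x \<noteq> f' y) * w x * w y) = sum w B * sum w N"
        unfolding sum_product using ne by (intro sum.cong refl) (metis fB fN mult_1 of_bool_eq(2))
      moreover have "(\<Sum>x\<in>N. \<Sum>y\<in>B. of_bool (f' x \<noteq> f' y) * w x * w y) = sum w N * sum w B"
        unfolding sum_product using ne by (intro sum.cong refl) (metis fB fN mult_1 of_bool_eq(2))
      moreover have "(\<Sum>x\<in>B. \<Sum>y\<in>B. of_bool (f' x \<noteq> f' y) * w x * w y) = 0"
        by (intro sum.neutral ballI) (simp add: fB)
      moreover have "(\<Sum>x\<in>N. \<Sum>y\<in>N. of_bool (f' x \<noteq> f' y) * w x * w y) =
         (\<Sum>x\<in>N. \<Sum>y\<in>N. of_bool (f x \<noteq> f y) * w x * w y)"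
        by (intro sum.cong refl) (simp add: fN)
      ultimately show ?thesis unfolding split by simp
    qed
    show ?thesis
      by (rule exI[of _ f'], intro conjI range) (use A1 A2 A3 IH key in linarith)
  qed
qed

text \<open>The sum over differently coloured pairs is the square of the total weight minus the sum of the
  squares of the class weights, and Cauchy-Schwarz bounds the latter from below.\<close>

lemma cross_weight_le:
  fixes w :: "'a \<Rightarrow> real"
  assumes "finite V" and "f ` V \<subseteq> {1..p}" and "p > 0"
  shows "(\<Sum>x\<in>V. \<Sum>y\<in>V. of_bool (f x \<noteq> f y) * w x * w y) \<le> (1 - 1 / real p) * (sum w V)\<^sup>2"
proof -
  define c where "c i = (\<Sum>x\<in>{x\<in>V. f x = i}. w x)" for i
  have tot: "sum w V = (\<Sum>i\<in>{1..p}. c i)"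
    unfolding c_def using assms(1,2) by (subst sum.group) auto
  have "(sum w V)\<^sup>2 - (\<Sum>x\<in>V. \<Sum>y\<in>V. of_bool (f x \<noteq> f y) * w x * w y)
      = (\<Sum>x\<in>V. \<Sum>y\<in>V. of_bool (f x = f y) * w x * w y)"
    unfolding power2_eq_square sum_product sum_subtractf[symmetric]
    by (intro sum.cong refl) auto
  also have "\<dots> = (\<Sum>x\<in>V. w x * c (f x))"
    unfolding c_def sum_distrib_left using assms(1)
    by (intro sum.cong[of V V, OF refl]) (subst sum.inter_filter; auto intro!: sum.cong)
  also have "\<dots> = (\<Sum>i\<in>{1..p}. \<Sum>x\<in>{x\<in>V. f x = i}. w x * c (f x))"
    using assms(1,2) by (subst sum.group) auto
  also have "\<dots> = (\<Sum>i\<in>{1..p}. (c i)\<^sup>2)"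
    by (intro sum.cong refl) (auto simp: c_def power2_eq_square sum_distrib_right)
  finally have e: "(\<Sum>x\<in>V. \<Sum>y\<in>V. of_bool (f x \<noteq> f y) * w x * w y)
     = (sum w V)\<^sup>2 - (\<Sum>i\<in>{1..p}. (c i)\<^sup>2)" by simp
  have "(sum w V)\<^sup>2 \<le> real p * (\<Sum>i\<in>{1..p}. (c i)\<^sup>2)"
    unfolding tot using sum_squared_le_sum_of_squares[of c "{1..p}"] by (simp add: mult.commute)
  then show ?thesis unfolding e using assms(3) by (simp add: field_simps)
qed

lemma weighted_turan:
  fixes w :: "'a \<Rightarrow> real" and R :: "'a \<Rightarrow> 'a \<Rightarrow> bool"
  assumes "finite V" and w: "\<And>v. v \<in> V \<Longrightarrow> 0 \<le> w v"
    and "\<And>u v. R u v \<Longrightarrow> R v u"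
    and "\<And>S. S \<subseteq> V \<Longrightarrow> card S = Suc p \<Longrightarrow> \<exists>u\<in>S. \<exists>v\<in>S. u \<noteq> v \<and> \<not> R u v"
    and "\<And>v. \<not> R v v" and "p > 0"
  shows "(\<Sum>x\<in>V. \<Sum>y\<in>V. of_bool (R x y) * w x * w y) \<le> (1 - 1 / real p) * (sum w V)\<^sup>2"
proof -
  obtain f where f: "f ` V \<subseteq> {1..p}" and le:
    "(\<Sum>x\<in>V. \<Sum>y\<in>V. of_bool (R x y) * w x * w y)
      + (\<Sum>x\<in>V. \<Sum>y\<in>V. of_bool (R x y \<and> f x = f y) * w x * w y)
      \<le> (\<Sum>x\<in>V. \<Sum>y\<in>V. of_bool (f x \<noteq> f y) * w x * w y)"
    using coloring_of_clique_free_relation[of V w R p, OF assms(1-5)] by blast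
  have "0 \<le> (\<Sum>x\<in>V. \<Sum>y\<in>V. of_bool (R x y \<and> f x = f y) * w x * w y)"
    using w by (intro sum_nonneg mult_nonneg_nonneg) auto
  then show ?thesis using le cross_weight_le[OF assms(1) f assms(6), of w] by linarith
qed


section \<open>Averages over subsets of an edge\<close>

definition codegree :: "'a set set \<Rightarrow> 'a set \<Rightarrow> nat" where
  "codegree E A = card {e \<in> E. A \<subseteq> e}"

definition subsets_of_size :: "nat \<Rightarrow> 'a set \<Rightarrow> 'a set set" where
  "subsets_of_size k A = {B. B \<subseteq> A \<and> card B = k}"

text \<open>The triples \<open>(C, y, z)\<close> in which \<open>y\<close> and \<open>z\<close> are two further distinct points besides those of
  the \<open>k\<close>-set \<open>C\<close>. Keeping \<open>y\<close> and \<open>z\<close> ordered makes every marginal a plain multiple of a sum over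
  subsets.\<close>

definition flags :: "nat \<Rightarrow> 'a set \<Rightarrow> ('a set \<times> 'a \<times> 'a) set" where
  "flags k A = (SIGMA C:subsets_of_size k A. SIGMA y:A - C. A - C - {y})"

lemma finite_subsets_of_size [simp]: "finite A \<Longrightarrow> finite (subsets_of_size k A)"
  by (simp add: subsets_of_size_def)

lemma card_subsets_of_size: "finite A \<Longrightarrow> card (subsets_of_size k A) = card A choose k"
  by (simp add: subsets_of_size_def n_subsets)

lemma finite_flags [simp]: "finite A \<Longrightarrow> finite (flags k A)"
  by (auto simp: flags_def)

lemma sum_flags:
  assumes "finite A"
  shows "(\<Sum>(C, y, z)\<in>flags k A. F C y z) =
    (\<Sum>C\<in>subsets_of_size k A. \<Sum>y\<in>A - C. \<Sum>z\<in>A - C - {y}. F C y z)"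
  unfolding flags_def using assms by (simp add: sum.Sigma)

text \<open>Each \<open>(k + 1)\<close>-set arises from \<open>k + 1\<close> pairs of a \<open>k\<close>-set and a further point.\<close>

lemma sum_extend_subset:
  fixes h :: "'a set \<Rightarrow> real"
  assumes fin: "finite A"
  shows "(\<Sum>C\<in>subsets_of_size k A. \<Sum>y\<in>A - C. h (insert y C)) =
    real (Suc k) * (\<Sum>B\<in>subsets_of_size (Suc k) A. h B)"
proof -
  have "(\<Sum>y\<in>A - C. h (insert y C)) = (\<Sum>B\<in>{B\<in>subsets_of_size (Suc k) A. C \<subseteq> B}. h B)"
    if C: "C \<in> subsets_of_size k A" for C
  proof (rule sum.reindex_bij_betw)
    have fC: "finite C" "card C = k" "C \<subseteq> A"
      using C fin finite_subset by (auto simp: subsets_of_size_def)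
    show "bij_betw (\<lambda>y. insert y C) (A - C) {B \<in> subsets_of_size (Suc k) A. C \<subseteq> B}"
    proof (rule bij_betw_imageI)
      show "inj_on (\<lambda>y. insert y C) (A - C)" by (auto simp: inj_on_def)
      have "B \<in> (\<lambda>y. insert y C) ` (A - C)" if B: "B \<subseteq> A" "card B = Suc k" "C \<subseteq> B" for B
      proof -
        have "card (B - C) = 1" using B fC by (simp add: card_Diff_subset)
        then obtain y where "B - C = {y}" by (auto simp: card_1_singleton_iff)
        then show ?thesis using B by (auto intro!: image_eqI[of _ _ y])
      qed
      then show "(\<lambda>y. insert y C) ` (A - C) = {B \<in> subsets_of_size (Suc k) A. C \<subseteq> B}"
        using fC by (auto simp: subsets_of_size_def)
    qed
  qed
  then have "(\<Sum>C\<in>subsets_of_size k A. \<Sum>y\<in>A - C. h (insert y C)) =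
      (\<Sum>C\<in>subsets_of_size k A. \<Sum>B\<in>{B\<in>subsets_of_size (Suc k) A. C \<subseteq> B}. h B)"
    by (rule sum.cong[OF refl])
  also have "\<dots> = (\<Sum>B\<in>subsets_of_size (Suc k) A. \<Sum>C\<in>{C\<in>subsets_of_size k A. C \<subseteq> B}. h B)"
    using fin by (intro sum.swap_restrict) auto
  also have "\<dots> = (\<Sum>B\<in>subsets_of_size (Suc k) A. real (Suc k) * h B)"
  proof (rule sum.cong[OF refl])
    fix B assume B: "B \<in> subsets_of_size (Suc k) A"
    then have "{C\<in>subsets_of_size k A. C \<subseteq> B} = subsets_of_size k B"
      by (auto simp: subsets_of_size_def)
    moreover have "card (subsets_of_size k B) = Suc k"
      using B fin by (subst card_subsets_of_size) (auto simp: subsets_of_size_def intro: finite_subset)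
    ultimately show "(\<Sum>C\<in>{C\<in>subsets_of_size k A. C \<subseteq> B}. h B) = real (Suc k) * h B" by simp
  qed
  finally show ?thesis by (simp add: sum_distrib_left)
qed

definition num_flags :: "nat \<Rightarrow> nat \<Rightarrow> real" where
  "num_flags r k = real (r choose k) * real (r - k) * real (r - Suc k)"

definition subset_avg :: "nat \<Rightarrow> ('a set \<Rightarrow> real) \<Rightarrow> 'a set \<Rightarrow> real" where
  "subset_avg k h A = (\<Sum>B\<in>subsets_of_size k A. h B) / real (card A choose k)"

lemma choose_Suc_mult: "real (Suc k) * real (r choose Suc k) = real (r choose k) * real (r - k)"
  by (metis binomial_absorb_comp binomial_absorption mult.commute of_nat_mult)

text \<open>Choosing a flag uniformly makes each of \<open>C\<close>, \<open>C \<union> {y}\<close>, \<open>C \<union> {z}\<close> and \<open>C \<union> {y, z}\<close>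
  a uniform subset of its size. Hence the sum over flags of the logarithm of a
  ratio of codegrees only involves averages over subsets of sizes \<open>k\<close>, \<open>k + 1\<close> and \<open>k + 2\<close>.\<close>

lemma
  fixes h :: "'a set \<Rightarrow> real"
  assumes fin: "finite A" and card: "card A = r" and k: "Suc (Suc k) \<le> r"
  shows sum_flags_base: "(\<Sum>(C, y, z)\<in>flags k A. h C) = num_flags r k * subset_avg k h A"
    and sum_flags_left: "(\<Sum>(C, y, z)\<in>flags k A. h (insert y C)) = num_flags r k * subset_avg (Suc k) h A"
    and sum_flags_right: "(\<Sum>(C, y, z)\<in>flags k A. h (insert z C)) = num_flags r k * subset_avg (Suc k) h A"
    and sum_flags_full: "(\<Sum>(C, y, z)\<in>flags k A. h (insert y (insert z C))) =
      num_flags r k * subset_avg (Suc (Suc k)) h A"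
    and card_flags: "real (card (flags k A)) = num_flags r k"
proof -
  have sz: "card (A - C) = r - k" "C \<subseteq> A" "finite C" "card C = k" if "C \<in> subsets_of_size k A" for C
    using that fin card by (auto simp: subsets_of_size_def card_Diff_subset finite_subset)
  have sz2: "card (A - C - {y}) = r - Suc k" if "C \<in> subsets_of_size k A" "y \<in> A - C" for C y
    using that sz fin by simp
  have ch: "real (r choose k) \<noteq> 0" "real (r choose Suc k) \<noteq> 0" "real (r choose Suc (Suc k)) \<noteq> 0"
    using k by auto
  show base: "(\<Sum>(C, y, z)\<in>flags k A. h C) = num_flags r k * subset_avg k h A" for h :: "'a set \<Rightarrow> real"
  proof -
    have "(\<Sum>(C, y, z)\<in>flags k A. h C) = (\<Sum>C\<in>subsets_of_size k A. real (r - k) * real (r - Suc k) * h C)"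
      unfolding sum_flags[OF fin] by (intro sum.cong refl) (simp add: sz sz2)
    then show ?thesis
      unfolding num_flags_def subset_avg_def card sum_distrib_left[symmetric] using ch by simp
  qed
  show left: "(\<Sum>(C, y, z)\<in>flags k A. h (insert y C)) = num_flags r k * subset_avg (Suc k) h A"
  proof -
    have "(\<Sum>(C, y, z)\<in>flags k A. h (insert y C)) =
       (\<Sum>C\<in>subsets_of_size k A. \<Sum>y\<in>A - C. real (r - Suc k) * h (insert y C))"
      unfolding sum_flags[OF fin] by (intro sum.cong refl) (simp only: sum_constant sz2)
    also have "\<dots> = real (r - Suc k) * (real (Suc k) * (\<Sum>B\<in>subsets_of_size (Suc k) A. h B))"
      by (simp only: sum_distrib_left[symmetric] sum_extend_subset[OF fin])
    also have "\<dots> = num_flags r k * subset_avg (Suc k) h A"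
      unfolding num_flags_def subset_avg_def card choose_Suc_mult[symmetric]
      using ch by simp
    finally show ?thesis .
  qed
  have "(\<Sum>(C, y, z)\<in>flags k A. h (insert z C)) = (\<Sum>(C, y, z)\<in>flags k A. h (insert y C))"
    by (rule sum.reindex_bij_witness[of _ "\<lambda>(C, y, z). (C, z, y)" "\<lambda>(C, y, z). (C, z, y)"])
      (auto simp: flags_def)
  then show "(\<Sum>(C, y, z)\<in>flags k A. h (insert z C)) = num_flags r k * subset_avg (Suc k) h A"
    using left by simp
  show "(\<Sum>(C, y, z)\<in>flags k A. h (insert y (insert z C))) =
      num_flags r k * subset_avg (Suc (Suc k)) h A"
  proof -
    have "(\<Sum>(C, y, z)\<in>flags k A. h (insert y (insert z C))) =
       (\<Sum>C\<in>subsets_of_size k A. \<Sum>y\<in>A - C. \<Sum>z\<in>A - insert y C. h (insert z (insert y C)))"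
      unfolding sum_flags[OF fin] by (intro sum.cong refl) (auto simp: insert_commute)
    also have "\<dots> = real (Suc k) * (real (Suc (Suc k)) * (\<Sum>B\<in>subsets_of_size (Suc (Suc k)) A. h B))"
      by (simp only: sum_extend_subset[OF fin, of "\<lambda>B. \<Sum>z\<in>A - B. h (insert z B)" k] sum_extend_subset[OF fin])
    also have "\<dots> = (real (Suc k) * real (r choose Suc k) * real (r - Suc k)) * subset_avg (Suc (Suc k)) h A"
      unfolding subset_avg_def card mult.assoc choose_Suc_mult[of "Suc k", symmetric]
      using ch by simp
    finally show ?thesis unfolding num_flags_def choose_Suc_mult .
  qed
  have "card (subsets_of_size k A) = r choose k" using card_subsets_of_size fin card by blast
  then have "subset_avg k (\<lambda>_. 1) A = 1" using ch card by (simp add: subset_avg_def)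
  then show "real (card (flags k A)) = num_flags r k"
    using base[of "\<lambda>_. 1"] by (simp add: case_prod_unfold)
qed


section \<open>Codegrees in hypergraphs without pairwise covered large sets\<close>

text \<open>The number of edges through a \<open>k\<close>-set (with at most one vertex in each part) in the complete
  \<open>l\<close>-partite \<open>r\<close>-graph with all parts of size \<open>x / l\<close>.\<close>

definition partite_codegree :: "nat \<Rightarrow> nat \<Rightarrow> real \<Rightarrow> nat \<Rightarrow> real" where
  "partite_codegree l r x k = real (l - k choose (r - k)) * (x / real l) ^ (r - k)"

lemma partite_codegree_pos:
  assumes "0 < x" "0 < l" "r \<le> l" "k \<le> r"
  shows "0 < partite_codegree l r x k"
  using assms by (auto simp: partite_codegree_def zero_less_binomial_iff intro!: mult_pos_pos)

lemma partite_codegree_rec: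
  assumes "k < r" "r \<le> l"
  shows "partite_codegree l r x k * real (r - k) =
    real (l - k) * (x / real l) * partite_codegree l r x (Suc k)"
proof -
  obtain d where d: "r - k = Suc d" "d = r - Suc k" using assms by (metis Suc_diff_Suc)
  have lk: "l - Suc k = l - k - 1" by simp
  have "Suc d * (l - k choose Suc d) = (l - k) * (l - Suc k choose d)"
    unfolding lk by (rule binomial_absorption)
  then have "real (Suc d) * real (l - k choose Suc d) = real (l - k) * real (l - Suc k choose d)"
    by (metis of_nat_mult)
  then have "real (Suc d) * real (l - k choose Suc d) * (x / real l) ^ Suc d =
      real (l - k) * real (l - Suc k choose d) * (x / real l) ^ Suc d" by simp
  then show ?thesis
    unfolding partite_codegree_def d(2)[symmetric] d(1) by (simp only: power_Suc mult_ac)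
qed

lemma partite_codegree_full [simp]: "partite_codegree l r x r = 1"
  by (simp add: partite_codegree_def)

locale clique_free_hypergraph =
  fixes V :: "'a set" and E :: "'a set set" and r l :: nat
  assumes finite_V: "finite V"
    and edge: "e \<in> E \<Longrightarrow> e \<subseteq> V \<and> card e = r"
    and nonempty: "E \<noteq> {}"
    and r_ge: "2 \<le> r" and r_le: "r \<le> l"
    and uncovered_pair: "S \<subseteq> V \<Longrightarrow> card S = Suc l \<Longrightarrow> \<exists>u\<in>S. \<exists>v\<in>S. u \<noteq> v \<and> \<not> (\<exists>e\<in>E. {u, v} \<subseteq> e)"
begin

lemma finite_E: "finite E"
  using finite_V edge by (meson PowI finite_Pow_iff finite_subset subsetI)

lemma finite_edge: "e \<in> E \<Longrightarrow> finite e"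
  using edge finite_V finite_subset by blast

lemma card_E_pos: "0 < card E"
  using finite_E nonempty by (simp add: card_gt_0_iff)

lemma codegree_pos_iff: "0 < codegree E A \<longleftrightarrow> (\<exists>e\<in>E. A \<subseteq> e)"
  unfolding codegree_def using finite_E by (auto simp: card_gt_0_iff)

lemma codegree_edge: "e \<in> E \<Longrightarrow> codegree E e = 1"
proof -
  assume e: "e \<in> E"
  have "e' = e" if "e' \<in> E" "e \<subseteq> e'" for e'
    using card_subset_eq[OF finite_edge[OF that(1)] that(2)] edge[OF e] edge[OF that(1)] by simp
  then have "{e' \<in> E. e \<subseteq> e'} = {e}" using e by blast
  then show ?thesis by (simp add: codegree_def)
qed

lemma codegree_empty: "codegree E {} = card E"
  by (simp add: codegree_def)

lemma sum_codegree_insert: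
  assumes "C \<subseteq> V" "card C = k"
  shows "(\<Sum>y\<in>V - C. codegree E (insert y C)) = (r - k) * codegree E C"
proof -
  have "(\<Sum>y\<in>V - C. card {e\<in>{e\<in>E. C \<subseteq> e}. y \<in> e}) = (r - k) * card {e\<in>E. C \<subseteq> e}"
  proof (rule sum_multicount)
    show "finite (V - C)" "finite {e \<in> E. C \<subseteq> e}" using finite_V finite_E by auto
    show "\<forall>e\<in>{e \<in> E. C \<subseteq> e}. card {y \<in> V - C. y \<in> e} = r - k"
    proof
      fix e assume e: "e \<in> {e \<in> E. C \<subseteq> e}"
      then have "{y \<in> V - C. y \<in> e} = e - C" using edge by blast
      moreover have "finite C" using assms finite_V finite_subset by blast
      ultimately show "card {y \<in> V - C. y \<in> e} = r - k"
        using e edge assms by (simp add: card_Diff_subset)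
    qed
  qed
  moreover have "{e\<in>{e\<in>E. C \<subseteq> e}. y \<in> e} = {e\<in>E. insert y C \<subseteq> e}" for y by auto
  ultimately show ?thesis by (simp add: codegree_def)
qed

lemma sum_codegree_subsets:
  "(\<Sum>C\<in>subsets_of_size k V. codegree E C) = (r choose k) * card E"
  unfolding codegree_def
proof (rule sum_multicount)
  show "finite (subsets_of_size k V)" "finite E" using finite_V finite_E by auto
  show "\<forall>e\<in>E. card {C \<in> subsets_of_size k V. C \<subseteq> e} = r choose k"
  proof
    fix e assume e: "e \<in> E"
    then have "{C \<in> subsets_of_size k V. C \<subseteq> e} = subsets_of_size k e"
      using edge by (auto simp: subsets_of_size_def)
    then show "card {C \<in> subsets_of_size k V. C \<subseteq> e} = r choose k"
      using e edge finite_edge by (simp add: card_subsets_of_size)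
  qed
qed

text \<open>The weighted Turan bound in the link of \<open>C\<close>: a clique of size \<open>l - k + 1\<close> in the link,
  together with \<open>C\<close>, would be a set of \<open>l + 1\<close> pairwise covered vertices. The weight of \<open>y\<close> is
  \<open>d(C \<union> {y})\<close>, with total \<open>(r - k) * d(C)\<close>.\<close>

lemma link_turan:
  assumes C: "C \<subseteq> V" "card C = k" and k: "Suc (Suc k) \<le> r"
  shows "(\<Sum>y\<in>V - C. \<Sum>z\<in>V - C - {y}. of_bool (0 < codegree E (insert y (insert z C))) *
      real (codegree E (insert y C)) * real (codegree E (insert z C)))
    \<le> (1 - 1 / real (l - k)) * (real (r - k) * real (codegree E C))\<^sup>2"
proof -
  define R where "R y z \<longleftrightarrow> y \<noteq> z \<and> 0 < codegree E (insert y (insert z C))" for y z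
  have finC: "finite C" using C finite_V finite_subset by blast
  have "(\<Sum>y\<in>V - C. \<Sum>z\<in>V - C - {y}. of_bool (0 < codegree E (insert y (insert z C))) *
      real (codegree E (insert y C)) * real (codegree E (insert z C)))
    = (\<Sum>y\<in>V - C. \<Sum>z\<in>V - C. of_bool (R y z) *
      real (codegree E (insert y C)) * real (codegree E (insert z C)))"
    by (intro sum.cong[of "V - C", OF refl] sum.mono_neutral_cong_left)
      (use finite_V in \<open>auto simp: R_def\<close>)
  also have "\<dots> \<le> (1 - 1 / real (l - k)) * (\<Sum>y\<in>V - C. real (codegree E (insert y C)))\<^sup>2"
  proof (rule weighted_turan)
    show "finite (V - C)" using finite_V by simp
    show "0 < l - k" using k r_le by simp
    show "R v u" if "R u v" for u v using that by (auto simp: R_def insert_commute)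
    show "\<not> R v v" for v by (simp add: R_def)
    fix S assume S: "S \<subseteq> V - C" "card S = Suc (l - k)"
    have finS: "finite S" using S finite_V finite_subset by fastforce
    have "S \<inter> C = {}" using S by blast
    then have "card (S \<union> C) = Suc l" using S C k r_le finS finC by (simp add: card_Un_disjoint)
    moreover have "S \<union> C \<subseteq> V" using S C by blast
    ultimately obtain u v where uv: "u \<in> S \<union> C" "v \<in> S \<union> C" "u \<noteq> v" "\<not> (\<exists>e\<in>E. {u, v} \<subseteq> e)"
      using uncovered_pair[of "S \<union> C"] by blast
    show "\<exists>u\<in>S. \<exists>v\<in>S. u \<noteq> v \<and> \<not> R u v"
    proof (rule ccontr)
      assume "\<not> ?thesis"
      then have all: "R a b" if "a \<in> S" "b \<in> S" "a \<noteq> b" for a b using that by blast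
      have cov: "\<exists>e\<in>E. insert a C \<subseteq> e" if "a \<in> S" for a
      proof -
        have "S \<noteq> {a}" using S k r_le by auto
        then obtain b where b: "b \<in> S" "a \<noteq> b" using \<open>a \<in> S\<close> by auto
        then show ?thesis using all[OF that b] unfolding R_def codegree_pos_iff by blast
      qed
      have "S \<noteq> {}" using S by auto
      then obtain a where "a \<in> S" by blast
      consider "u \<in> S" "v \<in> S" | "u \<in> S" "v \<in> C" | "u \<in> C" "v \<in> S" | "u \<in> C" "v \<in> C"
        using uv by blast
      then have "\<exists>e\<in>E. {u, v} \<subseteq> e"
      proof cases
        case 1 then show ?thesis using all[of u v] uv unfolding R_def codegree_pos_iff by blast
      next
        case 2 then show ?thesis using cov[of u] by blast
      next
        case 3 then show ?thesis using cov[of v] by blast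
      next
        case 4 then show ?thesis using cov[of a] \<open>a \<in> S\<close> by blast
      qed
      then show False using uv by blast
    qed
  qed auto
  also have "(\<Sum>y\<in>V - C. real (codegree E (insert y C))) = real (r - k) * real (codegree E C)"
    using sum_codegree_insert[OF C] by (metis of_nat_mult of_nat_sum)
  finally show ?thesis .
qed

lemma sum_edges_flags:
  fixes F :: "'a set \<Rightarrow> 'a \<Rightarrow> 'a \<Rightarrow> real"
  shows "(\<Sum>e\<in>E. \<Sum>(C, y, z)\<in>flags k e. F C y z) =
    (\<Sum>(C, y, z)\<in>flags k V. real (codegree E (insert y (insert z C))) * F C y z)"
proof -
  have fl: "flags k e = {t\<in>flags k V. case t of (C, y, z) \<Rightarrow> insert y (insert z C) \<subseteq> e}" if "e \<in> E" for e
    using edge[OF that] by (auto simp: flags_def subsets_of_size_def)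
  have "(\<Sum>e\<in>E. \<Sum>(C, y, z)\<in>flags k e. F C y z) =
    (\<Sum>e\<in>E. \<Sum>t\<in>{t\<in>flags k V. case t of (C, y, z) \<Rightarrow> insert y (insert z C) \<subseteq> e}. case t of (C, y, z) \<Rightarrow> F C y z)"
    by (intro sum.cong[OF refl] sum.cong[OF fl refl])
  also have "\<dots> = (\<Sum>t\<in>flags k V. \<Sum>e\<in>{e\<in>E. case t of (C, y, z) \<Rightarrow> insert y (insert z C) \<subseteq> e}. case t of (C, y, z) \<Rightarrow> F C y z)"
    using finite_E finite_V by (intro sum.swap_restrict) auto
  also have "\<dots> = (\<Sum>(C, y, z)\<in>flags k V. real (codegree E (insert y (insert z C))) * F C y z)"
    by (intro sum.cong refl) (auto simp: codegree_def)
  finally show ?thesis .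
qed

lemma sum_edges_subsets:
  fixes F :: "'a set \<Rightarrow> real"
  shows "(\<Sum>e\<in>E. \<Sum>A\<in>subsets_of_size k e. F A) =
    (\<Sum>A\<in>subsets_of_size k V. real (codegree E A) * F A)"
proof -
  have fl: "subsets_of_size k e = {A\<in>subsets_of_size k V. A \<subseteq> e}" if "e \<in> E" for e
    using edge[OF that] by (auto simp: subsets_of_size_def)
  have "(\<Sum>e\<in>E. \<Sum>A\<in>subsets_of_size k e. F A) =
    (\<Sum>e\<in>E. \<Sum>A\<in>{A\<in>subsets_of_size k V. A \<subseteq> e}. F A)"
    by (intro sum.cong[OF refl] sum.cong[OF fl refl])
  also have "\<dots> = (\<Sum>A\<in>subsets_of_size k V. \<Sum>e\<in>{e\<in>E. A \<subseteq> e}. F A)"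
    using finite_E finite_V by (intro sum.swap_restrict) auto
  finally show ?thesis by (simp add: codegree_def)
qed

end


section \<open>Normalised codegrees and the convexity of their average logarithms\<close>

text \<open>The defect in the inequality \<open>ln u \<le> u - 1\<close> controls the distance of \<open>u\<close> from 1. Taking the square
  root first gives a quadratic lower bound that is valid for all positive \<open>u\<close>.\<close>

lemma sqrt_minus_one_sq_le:
  fixes u :: real
  assumes "0 < u"
  shows "(sqrt u - 1)\<^sup>2 \<le> u - 1 - ln u"
proof -
  have "ln (sqrt u) \<le> sqrt u - 1" using assms by (intro ln_le_minus_one) simp
  then have "ln u / 2 \<le> sqrt u - 1" using assms by (simp add: ln_sqrt)
  moreover have "(sqrt u - 1)\<^sup>2 = u - 2 * sqrt u + 1"
    using assms by (simp add: power2_eq_square algebra_simps)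
  ultimately show ?thesis by linarith
qed

lemma abs_ln_le_of_sqrt_near_one:
  fixes u :: real
  assumes "0 < u" and "\<bar>sqrt u - 1\<bar> \<le> s" and "s \<le> 1 / 2"
  shows "\<bar>ln u\<bar> \<le> 4 * s"
proof -
  have u: "ln u = 2 * ln (sqrt u)" using assms by (simp add: ln_sqrt)
  have "ln (sqrt u) \<le> sqrt u - 1" using assms by (intro ln_le_minus_one) simp
  then have up: "ln (sqrt u) \<le> s" using assms by linarith
  have "ln (inverse (sqrt u)) \<le> inverse (sqrt u) - 1" using assms by (intro ln_le_minus_one) simp
  then have "- ln (sqrt u) \<le> inverse (sqrt u) - 1" using assms by (simp add: ln_inverse)
  also have "\<dots> \<le> 2 * s"
  proof -
    have "1 - s \<le> sqrt u" using assms by linarith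
    then have "inverse (sqrt u) \<le> inverse (1 - s)" using assms by (intro le_imp_inverse_le) auto
    moreover have "inverse (1 - s) - 1 \<le> 2 * s"
    proof -
      have "0 \<le> s" using assms(2) by linarith
      then have "1 \<le> (1 + 2 * s) * (1 - s)" using assms(3) mult_left_mono[of "2 * s" 1 s] by (simp add: algebra_simps)
      then show ?thesis using assms(3) by (simp add: field_simps)
    qed
    ultimately show ?thesis by linarith
  qed
  finally show ?thesis unfolding u using up by linarith
qed

text \<open>Summation by parts. Applied to a convex sequence it expresses a combination of the end values
  as a sum of nonnegative slacks.\<close>

lemma weighted_sum_second_difference:
  fixes a :: "nat \<Rightarrow> real"
  shows "(\<Sum>j<n. real (Suc j) * (a j - 2 * a (Suc j) + a (Suc (Suc j)))) =
    a 0 - real (Suc n) * a n + real n * a (Suc n)"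
  by (induction n) (auto simp: algebra_simps)

locale shadow_tight_hypergraph = clique_free_hypergraph +
  fixes x :: real
  assumes x_pos: "0 < x"
    and card_shadow: "real (card {A. A \<subseteq> V \<and> card A = r - 1 \<and> (\<exists>B\<in>E. A \<subset> B)}) =
      real (l choose (r - 1)) * (x / real l) ^ (r - 1)"
begin

abbreviation model :: "nat \<Rightarrow> real" where
  "model \<equiv> partite_codegree l r x"

definition rel_codegree :: "'a set \<Rightarrow> real" where
  "rel_codegree A = real (codegree E A) / model (card A)"

text \<open>The density of the independent choice of \<open>y\<close> and \<open>z\<close> given \<open>C\<close>, relative to their joint law in a
  random edge, scaled so that it is 1 throughout in the balanced complete \<open>l\<close>-partite hypergraph.\<close>

definition flag_ratio :: "'a set \<Rightarrow> 'a \<Rightarrow> 'a \<Rightarrow> real" where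
  "flag_ratio C y z = rel_codegree (insert y C) * rel_codegree (insert z C) /
     (rel_codegree (insert y (insert z C)) * rel_codegree C)"

lemma model_pos: "k \<le> r \<Longrightarrow> 0 < model k"
  using partite_codegree_pos[of x l r k] x_pos r_ge r_le by simp

lemma rel_codegree_pos: "e \<in> E \<Longrightarrow> A \<subseteq> e \<Longrightarrow> 0 < rel_codegree A"
  unfolding rel_codegree_def using model_pos codegree_pos_iff
  by (metis card_mono divide_pos_pos edge finite_edge of_nat_0_less_iff)

lemma rel_codegree_edge: "e \<in> E \<Longrightarrow> rel_codegree e = 1"
  by (simp add: rel_codegree_def codegree_edge edge)

lemma flag_ratio_pos:
  assumes "e \<in> E" "(C, y, z) \<in> flags k e"
  shows "0 < flag_ratio C y z"
  unfolding flag_ratio_def using assms(2)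
  by (intro divide_pos_pos mult_pos_pos rel_codegree_pos[OF assms(1)])
    (auto simp: flags_def subsets_of_size_def)

lemma ln_flag_ratio:
  assumes "e \<in> E" "(C, y, z) \<in> flags k e"
  shows "ln (flag_ratio C y z) = ln (rel_codegree (insert y C)) + ln (rel_codegree (insert z C))
    - ln (rel_codegree (insert y (insert z C))) - ln (rel_codegree C)"
proof -
  have "0 < rel_codegree (insert y C)" "0 < rel_codegree (insert z C)"
    "0 < rel_codegree (insert y (insert z C))" "0 < rel_codegree C"
    using assms(2) by (auto simp: flags_def subsets_of_size_def intro!: rel_codegree_pos[OF assms(1)])
  then show ?thesis by (simp add: flag_ratio_def ln_div ln_mult)
qed

text \<open>Equality in \<open>link_turan\<close> for the balanced complete \<open>l\<close>-partite hypergraph.\<close>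

lemma model_second_ratio:
  assumes k: "Suc (Suc k) \<le> r"
  shows "model (Suc (Suc k)) * model k / (model (Suc k))\<^sup>2 * ((1 - 1 / real (l - k)) * real (r - k)) =
    real (r - Suc k)"
proof -
  have p: "model (Suc k) \<noteq> 0" using model_pos[of "Suc k"] k by simp
  have lk: "real (l - k) > 1" "real (l - Suc k) = real (l - k) - 1" using k r_le by auto
  have e1: "model k * real (r - k) = real (l - k) * (x / real l) * model (Suc k)"
    using partite_codegree_rec k r_le by simp
  have e2: "model (Suc k) * real (r - Suc k) = real (l - Suc k) * (x / real l) * model (Suc (Suc k))"
    using partite_codegree_rec[of "Suc k"] k r_le by simp
  have "model (Suc (Suc k)) * model k / (model (Suc k))\<^sup>2 * ((1 - 1 / real (l - k)) * real (r - k))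
     = model (Suc (Suc k)) * (model k * real (r - k)) * (1 - 1 / real (l - k)) / (model (Suc k))\<^sup>2"
    by (simp add: algebra_simps)
  also have "\<dots> = (real (l - Suc k) * (x / real l) * model (Suc (Suc k))) / model (Suc k)"
  proof -
    have "M2 * (A * X * M1) * (1 - 1 / A) / M1\<^sup>2 = (A - 1) * X * M2 / M1"
      if "1 < A" "M1 \<noteq> 0" for A X M1 M2 :: real
    proof -
      have "A * (1 - 1 / A) = A - 1" using that by (simp add: right_diff_distrib)
      then have "M2 * (A * X * M1) * (1 - 1 / A) = M2 * X * M1 * (A - 1)"
        by (metis mult.assoc mult.commute)
      then show ?thesis using that by (simp add: power2_eq_square)
    qed
    then show ?thesis unfolding e1 lk(2) using lk(1) p by blast
  qed
  also have "\<dots> = real (r - Suc k)"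
    unfolding e2[symmetric] using p by simp
  finally show ?thesis .
qed

text \<open>A flag \<open>(C, y, z)\<close> lies in \<open>d(C \<union> {y, z})\<close> edges. This factor cancels the
  denominator of the ratio, leaving the sum over pairs in the link of \<open>C\<close> that \<open>link_turan\<close> bounds.\<close>

lemma sum_flag_ratio_le:
  assumes k: "Suc (Suc k) \<le> r"
  shows "(\<Sum>e\<in>E. \<Sum>(C, y, z)\<in>flags k e. flag_ratio C y z) \<le> num_flags r k * real (card E)"
proof -
  \<comment> \<open>The constant that collects the normalisations of the four codegrees in the ratio.\<close>
  define K where "K = model (Suc (Suc k)) * model k / (model (Suc k))\<^sup>2"
  have mp: "0 < model k" "0 < model (Suc k)" "0 < model (Suc (Suc k))" using model_pos k by auto
  have K: "0 < K" using mp by (simp add: K_def)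
  define P where "P C y z = of_bool (0 < codegree E (insert y (insert z C))) *
      real (codegree E (insert y C)) * real (codegree E (insert z C))" for C y z
  have "real (codegree E (insert y (insert z C))) * flag_ratio C y z = K / real (codegree E C) * P C y z"
    if "(C, y, z) \<in> flags k V" for C y z
  proof -
    have *: "C \<subseteq> V" "card C = k" "y \<notin> C" "z \<notin> C" "y \<noteq> z" "finite C"
      using that finite_V by (auto simp: flags_def subsets_of_size_def intro: finite_subset)
    then have cards: "card (insert y C) = Suc k" "card (insert z C) = Suc k"
      "card (insert y (insert z C)) = Suc (Suc k)" by auto
    have alg: "q * ((a / m1) * (b / m1) / ((q / m2) * (c / m0))) = m2 * m0 / m1\<^sup>2 / c * (1 * a * b)"
      if "q \<noteq> 0" for a b c q m0 m1 m2 :: real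
    proof -
      have "(q / m2) * (c / m0) = q * (c / (m2 * m0))" by simp
      then have "q * ((a / m1) * (b / m1) / ((q / m2) * (c / m0))) =
          q * ((a / m1) * (b / m1) / (q * (c / (m2 * m0))))" by (rule arg_cong)
      also have "\<dots> = (a / m1) * (b / m1) / (c / (m2 * m0))" using that by simp
      finally show ?thesis by (simp only: power2_eq_square times_divide_times_eq
          divide_divide_eq_left divide_divide_eq_right times_divide_eq_left times_divide_eq_right mult_ac mult_1)
    qed
    show ?thesis
    proof (cases "codegree E (insert y (insert z C)) = 0")
      case True
      then show ?thesis by (simp only: P_def of_nat_0 less_irrefl of_bool_eq mult_zero_left mult_zero_right)
    next
      case False
      then have "of_bool (0 < codegree E (insert y (insert z C))) = (1 :: real)"
        and "real (codegree E (insert y (insert z C))) \<noteq> 0" by auto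
      then show ?thesis
        unfolding flag_ratio_def rel_codegree_def P_def K_def cards \<open>card C = k\<close>
        by (simp only: alg not_False_eq_True)
    qed
  qed
  then have "(\<Sum>e\<in>E. \<Sum>(C, y, z)\<in>flags k e. flag_ratio C y z) =
     (\<Sum>(C, y, z)\<in>flags k V. K / real (codegree E C) * P C y z)"
    unfolding sum_edges_flags by (intro sum.cong refl) auto
  also have "\<dots> = (\<Sum>C\<in>subsets_of_size k V. K / real (codegree E C) * (\<Sum>y\<in>V - C. \<Sum>z\<in>V - C - {y}. P C y z))"
    unfolding sum_flags[OF finite_V] by (simp add: sum_distrib_left)
  also have "\<dots> \<le> (\<Sum>C\<in>subsets_of_size k V. K / real (codegree E C) *
      ((1 - 1 / real (l - k)) * (real (r - k) * real (codegree E C))\<^sup>2))"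
    unfolding P_def using K
    by (intro sum_mono mult_left_mono link_turan k) (auto simp: subsets_of_size_def)
  also have "\<dots> = (\<Sum>C\<in>subsets_of_size k V. (real (r - k) * real (r - Suc k)) * real (codegree E C))"
  proof (rule sum.cong[OF refl])
    fix C
    have "K / real (codegree E C) * ((1 - 1 / real (l - k)) * (real (r - k) * real (codegree E C))\<^sup>2)
      = (K * ((1 - 1 / real (l - k)) * real (r - k))) * real (r - k) * real (codegree E C)"
      by (simp add: power2_eq_square)
    then show "K / real (codegree E C) * ((1 - 1 / real (l - k)) * (real (r - k) * real (codegree E C))\<^sup>2)
      = (real (r - k) * real (r - Suc k)) * real (codegree E C)"
      unfolding K_def model_second_ratio[OF k] by simp
  qed
  also have "\<dots> = num_flags r k * real (card E)"
    unfolding sum_distrib_left[symmetric] of_nat_sum[symmetric] sum_codegree_subsets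
    by (simp add: num_flags_def)
  finally show ?thesis .
qed

lemma shadow_eq:
  "{A\<in>subsets_of_size (r - 1) V. 0 < codegree E A} =
   {A. A \<subseteq> V \<and> card A = r - 1 \<and> (\<exists>B\<in>E. A \<subset> B)}"
proof -
  have "A \<noteq> B" if "B \<in> E" "card A = r - 1" for A B
    using that edge[of B] r_ge by auto
  then have "(\<exists>B\<in>E. A \<subseteq> B) \<longleftrightarrow> (\<exists>B\<in>E. A \<subset> B)" if "card A = r - 1" for A
    using that by (metis psubset_eq)
  then show ?thesis unfolding subsets_of_size_def codegree_pos_iff by auto
qed

text \<open>Two counts of the pairs of an edge and an \<open>(r - 1)\<close>-subset of it in the balanced complete
  \<open>l\<close>-partite hypergraph.\<close>

lemma model_shadow:
  "real r * model 0 = model (r - 1) * (real (l choose (r - 1)) * (x / real l) ^ (r - 1))"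
proof -
  have "real (Suc (r - 1)) * real (l choose Suc (r - 1)) = real (l choose (r - 1)) * real (l - (r - 1))"
    by (rule choose_Suc_mult)
  then have *: "real r * real (l choose r) = real (l choose (r - 1)) * real (l - (r - 1))"
    using r_ge by simp
  have "(x / real l) ^ r = (x / real l) * (x / real l) ^ (r - 1)"
    using r_ge by (simp flip: power_Suc)
  then have "real r * model 0 = (real r * real (l choose r)) * ((x / real l) * (x / real l) ^ (r - 1))"
    unfolding partite_codegree_def by simp
  also have "\<dots> = model (r - 1) * (real (l choose (r - 1)) * (x / real l) ^ (r - 1))"
    unfolding * partite_codegree_def using r_ge by simp
  finally show ?thesis .
qed

text \<open>Each shadow set \<open>A\<close> lies in \<open>d(A)\<close> edges, so the sum counts the shadow, up to a factor; the
  prescribed shadow size makes the average exactly 1.\<close>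

lemma sum_shadow_ratio:
  "(\<Sum>e\<in>E. \<Sum>A\<in>subsets_of_size (r - 1) e. rel_codegree {} / rel_codegree A) = real r * real (card E)"
proof -
  let ?S = "subsets_of_size (r - 1) V"
  have m: "0 < model 0" "0 < model (r - 1)" using model_pos by auto
  have "(\<Sum>e\<in>E. \<Sum>A\<in>subsets_of_size (r - 1) e. rel_codegree {} / rel_codegree A) =
    (\<Sum>A\<in>?S. of_bool (0 < codegree E A) * (real (card E) * model (r - 1) / model 0))"
    unfolding sum_edges_subsets
    by (intro sum.cong refl)
      (auto simp: rel_codegree_def subsets_of_size_def codegree_empty)
  also have "\<dots> = real (card {A\<in>?S. 0 < codegree E A}) * (real (card E) * model (r - 1) / model 0)"
  proof -
    have "(\<Sum>A\<in>?S. of_bool (0 < codegree E A) * c) = (\<Sum>A\<in>{A\<in>?S. 0 < codegree E A}. c)" for c :: real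
      by (rule sum.mono_neutral_cong_right) (use finite_V in auto)
    then show ?thesis by (simp only: sum_constant)
  qed
  also have "\<dots> = real (card E) * (model (r - 1) * (real (l choose (r - 1)) * (x / real l) ^ (r - 1))) / model 0"
    unfolding shadow_eq card_shadow by simp
  also have "\<dots> = real r * real (card E)"
    unfolding model_shadow[symmetric] using m by simp
  finally show ?thesis .
qed

definition avg_ln :: "nat \<Rightarrow> real" where
  "avg_ln k = (\<Sum>e\<in>E. subset_avg k (\<lambda>A. ln (rel_codegree A)) e) / real (card E)"

lemma avg_ln_eq: "(\<Sum>e\<in>E. subset_avg k (\<lambda>A. ln (rel_codegree A)) e) = real (card E) * avg_ln k"
  using card_E_pos by (simp add: avg_ln_def)

lemma avg_ln_0: "avg_ln 0 = ln (rel_codegree {})"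
proof -
  have "subsets_of_size 0 e = {{}}" if "e \<in> E" for e
    using finite_edge[OF that] by (auto simp: subsets_of_size_def finite_subset)
  then show ?thesis using card_E_pos by (simp add: avg_ln_def subset_avg_def)
qed

lemma avg_ln_r: "avg_ln r = 0"
proof -
  have "B = e" if "e \<in> E" "B \<subseteq> e" "card B = r" for e B
    using card_subset_eq[OF finite_edge[OF that(1)] that(2)] edge[OF that(1)] that(3) by simp
  then have "subsets_of_size r e = {e}" if "e \<in> E" for e
    using edge[OF that] that by (auto simp: subsets_of_size_def)
  then show ?thesis by (simp add: avg_ln_def subset_avg_def rel_codegree_edge)
qed

text \<open>Since the ratios have average at most 1, the sum of \<open>u - 1 - ln u\<close> over them is at most minus the
  sum of their logarithms, and this is a second difference of \<open>avg_ln\<close>. In particular \<open>avg_ln\<close> is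
  convex, and small second differences force the ratios to be near 1 in mean square.\<close>

lemma flag_deviation_le:
  assumes k: "Suc (Suc k) \<le> r"
  shows "(\<Sum>e\<in>E. \<Sum>(C, y, z)\<in>flags k e. (sqrt (flag_ratio C y z) - 1)\<^sup>2) \<le>
    num_flags r k * real (card E) * (avg_ln k - 2 * avg_ln (Suc k) + avg_ln (Suc (Suc k)))"
proof -
  let ?h = "\<lambda>A. ln (rel_codegree A)" and ?N = "num_flags r k"
  have "(\<Sum>e\<in>E. \<Sum>(C, y, z)\<in>flags k e. (sqrt (flag_ratio C y z) - 1)\<^sup>2) \<le>
    (\<Sum>e\<in>E. \<Sum>(C, y, z)\<in>flags k e. flag_ratio C y z - 1 -
      (?h (insert y C) + ?h (insert z C) - ?h (insert y (insert z C)) - ?h C))"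
    using sqrt_minus_one_sq_le[OF flag_ratio_pos]
    by (intro sum_mono) (auto simp: ln_flag_ratio[symmetric])
  also have "\<dots> = (\<Sum>e\<in>E. (\<Sum>(C, y, z)\<in>flags k e. flag_ratio C y z) - ?N -
      (2 * (?N * subset_avg (Suc k) ?h e) - ?N * subset_avg (Suc (Suc k)) ?h e - ?N * subset_avg k ?h e))"
  proof (rule sum.cong[OF refl])
    fix e assume "e \<in> E"
    then have e: "finite e" "card e = r" using finite_edge edge by auto
    have two: "2 * (?N * subset_avg (Suc k) ?h e) =
        (\<Sum>(C, y, z)\<in>flags k e. ?h (insert y C)) + (\<Sum>(C, y, z)\<in>flags k e. ?h (insert z C))"
      using sum_flags_left[OF e k, of ?h] sum_flags_right[OF e k, of ?h] by simp
    have "(\<Sum>(C, y, z)\<in>flags k e. flag_ratio C y z - 1 -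
      (?h (insert y C) + ?h (insert z C) - ?h (insert y (insert z C)) - ?h C)) =
      (\<Sum>(C, y, z)\<in>flags k e. flag_ratio C y z) - real (card (flags k e)) -
      ((\<Sum>(C, y, z)\<in>flags k e. ?h (insert y C)) + (\<Sum>(C, y, z)\<in>flags k e. ?h (insert z C))
        - (\<Sum>(C, y, z)\<in>flags k e. ?h (insert y (insert z C))) - (\<Sum>(C, y, z)\<in>flags k e. ?h C))"
      by (simp add: case_prod_unfold sum_subtractf sum.distrib)
    then show "(\<Sum>(C, y, z)\<in>flags k e. flag_ratio C y z - 1 -
      (?h (insert y C) + ?h (insert z C) - ?h (insert y (insert z C)) - ?h C)) =
      (\<Sum>(C, y, z)\<in>flags k e. flag_ratio C y z) - ?N -
      (2 * (?N * subset_avg (Suc k) ?h e) - ?N * subset_avg (Suc (Suc k)) ?h e - ?N * subset_avg k ?h e)"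
      unfolding two[symmetric] sum_flags_base[OF e k] sum_flags_full[OF e k, of ?h] card_flags[OF e k] .
  qed
  also have "\<dots> = (\<Sum>e\<in>E. \<Sum>(C, y, z)\<in>flags k e. flag_ratio C y z) - real (card E) * ?N -
      (2 * (?N * (real (card E) * avg_ln (Suc k))) - ?N * (real (card E) * avg_ln (Suc (Suc k)))
        - ?N * (real (card E) * avg_ln k))"
    by (simp add: sum_subtractf sum_distrib_left[symmetric] avg_ln_eq)
  also have "\<dots> \<le> - (2 * (?N * (real (card E) * avg_ln (Suc k))) - ?N * (real (card E) * avg_ln (Suc (Suc k)))
        - ?N * (real (card E) * avg_ln k))"
    using sum_flag_ratio_le[OF k] by (simp add: mult.commute)
  finally show ?thesis by (simp add: algebra_simps)
qed

lemma shadow_deviation_le: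
  "(\<Sum>e\<in>E. \<Sum>A\<in>subsets_of_size (r - 1) e. (sqrt (rel_codegree {} / rel_codegree A) - 1)\<^sup>2) \<le>
    real r * real (card E) * (avg_ln (r - 1) - avg_ln 0)"
proof -
  let ?h = "\<lambda>A. ln (rel_codegree A)"
  have pos: "0 < rel_codegree {}" "0 < rel_codegree A" if "e \<in> E" "A \<in> subsets_of_size (r - 1) e" for e A
    using that rel_codegree_pos[of e] by (auto simp: subsets_of_size_def)
  have "(\<Sum>e\<in>E. \<Sum>A\<in>subsets_of_size (r - 1) e. (sqrt (rel_codegree {} / rel_codegree A) - 1)\<^sup>2) \<le>
    (\<Sum>e\<in>E. \<Sum>A\<in>subsets_of_size (r - 1) e. rel_codegree {} / rel_codegree A - 1 - (?h {} - ?h A))"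
  proof (intro sum_mono)
    fix e A assume "e \<in> E" "A \<in> subsets_of_size (r - 1) e"
    note p = pos[OF this]
    show "(sqrt (rel_codegree {} / rel_codegree A) - 1)\<^sup>2 \<le> rel_codegree {} / rel_codegree A - 1 - (?h {} - ?h A)"
      using sqrt_minus_one_sq_le[of "rel_codegree {} / rel_codegree A"] p by (simp add: ln_div)
  qed
  also have "\<dots> = (\<Sum>e\<in>E. (\<Sum>A\<in>subsets_of_size (r - 1) e. rel_codegree {} / rel_codegree A) - real r
      - (real r * avg_ln 0 - real r * subset_avg (r - 1) ?h e))"
  proof (rule sum.cong[OF refl])
    fix e assume "e \<in> E"
    then have e: "finite e" "card e = r" using finite_edge edge by auto
    have ch: "r choose (r - 1) = r" using r_ge binomial_symmetric[of "r - 1" r] by simp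
    then have "card (subsets_of_size (r - 1) e) = r" using e by (simp add: card_subsets_of_size)
    then show "(\<Sum>A\<in>subsets_of_size (r - 1) e. rel_codegree {} / rel_codegree A - 1 - (?h {} - ?h A)) =
      (\<Sum>A\<in>subsets_of_size (r - 1) e. rel_codegree {} / rel_codegree A) - real r
      - (real r * avg_ln 0 - real r * subset_avg (r - 1) ?h e)"
      using ch e r_ge by (simp add: sum_subtractf subset_avg_def avg_ln_0)
  qed
  also have "\<dots> = real r * real (card E) * (avg_ln (r - 1) - avg_ln 0)"
    unfolding sum_subtractf sum_shadow_ratio sum_distrib_left[symmetric] avg_ln_eq
    by (simp add: algebra_simps)
  finally show ?thesis .
qed

end


section \<open>Regular edges\<close>

text \<open>A bound, up to the factor \<open>- ln (g({}))\<close>, on the total squared deviation per edge.\<close>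

definition deviation_weight :: "nat \<Rightarrow> real" where
  "deviation_weight r = real (r - 1) * ((\<Sum>k<r - 1. num_flags r k) + real r)"

lemma num_flags_pos: "Suc (Suc k) \<le> r \<Longrightarrow> 0 < num_flags r k"
  by (simp add: num_flags_def zero_less_binomial_iff)

lemma deviation_weight_pos:
  assumes "2 \<le> r"
  shows "0 < deviation_weight r"
proof -
  have "0 \<le> (\<Sum>k<r - 1. num_flags r k)"
    by (intro sum_nonneg num_flags_pos[THEN less_imp_le]) auto
  then show ?thesis unfolding deviation_weight_def using assms
    by (intro mult_pos_pos) auto
qed

context shadow_tight_hypergraph
begin

definition regular_edges :: "real \<Rightarrow> 'a set set" where
  "regular_edges s = {e \<in> E.
     (\<forall>k<r - 1. \<forall>(C, y, z)\<in>flags k e. \<bar>sqrt (flag_ratio C y z) - 1\<bar> \<le> s) \<and>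
     (\<forall>A\<in>subsets_of_size (r - 1) e. \<bar>sqrt (rel_codegree {} / rel_codegree A) - 1\<bar> \<le> s)}"

abbreviation second_diff :: "nat \<Rightarrow> real" where
  "second_diff k \<equiv> avg_ln k - 2 * avg_ln (Suc k) + avg_ln (Suc (Suc k))"

lemma second_diff_nonneg:
  assumes "k < r - 1"
  shows "0 \<le> second_diff k"
proof -
  have k: "Suc (Suc k) \<le> r" using assms by simp
  have "0 \<le> (\<Sum>e\<in>E. \<Sum>(C, y, z)\<in>flags k e. (sqrt (flag_ratio C y z) - 1)\<^sup>2)"
    by (intro sum_nonneg) auto
  then have "0 \<le> num_flags r k * real (card E) * second_diff k"
    using flag_deviation_le[OF k] by linarith
  moreover have "0 < num_flags r k * real (card E)" using num_flags_pos[OF k] card_E_pos by simp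
  ultimately show ?thesis using mult_le_cancel_left_pos by (metis mult_zero_right)
qed

lemma first_diff_nonneg: "0 \<le> avg_ln (r - 1) - avg_ln 0"
proof -
  have "0 \<le> (\<Sum>e\<in>E. \<Sum>A\<in>subsets_of_size (r - 1) e. (sqrt (rel_codegree {} / rel_codegree A) - 1)\<^sup>2)"
    by (intro sum_nonneg) auto
  then have "0 \<le> real r * real (card E) * (avg_ln (r - 1) - avg_ln 0)"
    using shadow_deviation_le by (rule order_trans)
  moreover have "0 < real r * real (card E)" using r_ge card_E_pos by simp
  ultimately show ?thesis using mult_le_cancel_left_pos by (metis mult_zero_right)
qed

text \<open>All slacks are nonnegative and their sum is a multiple of \<open>- avg_ln 0\<close>, which is small
  if the number of edges is nearly extremal. So each slack is small.\<close>

lemma total_slack: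
  "(\<Sum>j<r - 1. real (Suc j) * second_diff j) + real r * (avg_ln (r - 1) - avg_ln 0) =
    - real (r - 1) * avg_ln 0"
proof -
  have "Suc (r - 1) = r" using r_ge by simp
  then show ?thesis
    using weighted_sum_second_difference[of avg_ln "r - 1"] r_ge
    by (simp add: avg_ln_r algebra_simps of_nat_diff)
qed

lemma
  shows second_diff_le: "k < r - 1 \<Longrightarrow> second_diff k \<le> - real (r - 1) * avg_ln 0"
    and first_diff_le: "avg_ln (r - 1) - avg_ln 0 \<le> - real (r - 1) * avg_ln 0"
    and avg_ln_0_le: "avg_ln 0 \<le> 0"
proof -
  have n1: "0 \<le> (\<Sum>j<r - 1. real (Suc j) * second_diff j)"
    by (intro sum_nonneg mult_nonneg_nonneg second_diff_nonneg) auto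
  have n2: "avg_ln (r - 1) - avg_ln 0 \<le> real r * (avg_ln (r - 1) - avg_ln 0)"
    using mult_right_mono[of 1 "real r", OF _ first_diff_nonneg] r_ge by simp
  show "avg_ln (r - 1) - avg_ln 0 \<le> - real (r - 1) * avg_ln 0"
    using total_slack n1 n2 by linarith
  then have "real (r - 1) * avg_ln 0 \<le> real (r - 1) * 0" using first_diff_nonneg by linarith
  moreover have "0 < real (r - 1)" using r_ge by simp
  ultimately show "avg_ln 0 \<le> 0" using mult_le_cancel_left_pos by blast
  assume k: "k < r - 1"
  have "real (Suc k) * second_diff k \<le> (\<Sum>j<r - 1. real (Suc j) * second_diff j)"
    using k by (intro member_le_sum mult_nonneg_nonneg second_diff_nonneg) auto
  moreover have "second_diff k \<le> real (Suc k) * second_diff k"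
    using mult_right_mono[of 1 "real (Suc k)", OF _ second_diff_nonneg[OF k]] by simp
  ultimately show "second_diff k \<le> - real (r - 1) * avg_ln 0"
    using total_slack n2 first_diff_nonneg by linarith
qed

lemma rel_codegree_empty_le: "rel_codegree {} \<le> 1"
proof -
  obtain e where "e \<in> E" using nonempty by blast
  then have "0 < rel_codegree {}" using rel_codegree_pos by blast
  then show ?thesis using avg_ln_0_le unfolding avg_ln_0 by (simp add: ln_le_zero_iff)
qed

text \<open>Chebyshev's inequality: an irregular edge contributes at least \<open>s\<^sup>2\<close> to the total squared
  deviation, which is bounded by the slacks.\<close>

lemma irregular_edges_le:
  assumes "0 \<le> s"
  shows "real (card (E - regular_edges s)) * s\<^sup>2 \<le>
    real (card E) * deviation_weight r * - ln (rel_codegree {})"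
proof -
  define df where "df k e = (\<Sum>(C, y, z)\<in>flags k e. (sqrt (flag_ratio C y z) - 1)\<^sup>2)" for k e
  define ds where "ds e = (\<Sum>A\<in>subsets_of_size (r - 1) e. (sqrt (rel_codegree {} / rel_codegree A) - 1)\<^sup>2)" for e
  have nn: "0 \<le> df k e" "0 \<le> ds e" for k e
    unfolding df_def ds_def by (auto intro!: sum_nonneg)
  have "s\<^sup>2 \<le> (\<Sum>k<r - 1. df k e) + ds e" if e: "e \<in> E - regular_edges s" for e
  proof -
    have fe: "finite e" using e finite_edge by blast
    consider k C y z where "k < r - 1" "(C, y, z) \<in> flags k e" "s < \<bar>sqrt (flag_ratio C y z) - 1\<bar>"
      | A where "A \<in> subsets_of_size (r - 1) e" "s < \<bar>sqrt (rel_codegree {} / rel_codegree A) - 1\<bar>"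
      using e unfolding regular_edges_def by (auto simp: not_le)
    then show ?thesis
    proof cases
      case 1
      have "s\<^sup>2 \<le> (sqrt (flag_ratio C y z) - 1)\<^sup>2"
        using 1(3) assms by (intro abs_le_square_iff[THEN iffD1]) auto
      also have "\<dots> \<le> df k e"
        unfolding df_def using member_le_sum[OF 1(2), of "\<lambda>(C, y, z). (sqrt (flag_ratio C y z) - 1)\<^sup>2"] fe
        by auto
      also have "\<dots> \<le> (\<Sum>k<r - 1. df k e)"
        using 1(1) nn by (intro member_le_sum) auto
      finally show ?thesis using nn(2)[of e] by linarith
    next
      case 2
      have "s\<^sup>2 \<le> (sqrt (rel_codegree {} / rel_codegree A) - 1)\<^sup>2"
        using 2(2) assms by (intro abs_le_square_iff[THEN iffD1]) auto
      also have "\<dots> \<le> ds e"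
        unfolding ds_def using 2(1) fe by (intro member_le_sum) auto
      finally show ?thesis using sum_nonneg[of "{..<r - 1}" "\<lambda>k. df k e"] nn by fastforce
    qed
  qed
  then have "real (card (E - regular_edges s)) * s\<^sup>2 \<le> (\<Sum>e\<in>E - regular_edges s. (\<Sum>k<r - 1. df k e) + ds e)"
    by (rule sum_bounded_below)
  also have "\<dots> \<le> (\<Sum>e\<in>E. (\<Sum>k<r - 1. df k e) + ds e)"
    using finite_E nn by (intro sum_mono2) (auto intro!: add_nonneg_nonneg sum_nonneg)
  also have "\<dots> = (\<Sum>k<r - 1. \<Sum>e\<in>E. df k e) + (\<Sum>e\<in>E. ds e)"
    unfolding sum.distrib by (subst sum.swap) simp
  also have "\<dots> \<le> (\<Sum>k<r - 1. num_flags r k * real (card E) * (- real (r - 1) * avg_ln 0)) +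
      real r * real (card E) * (- real (r - 1) * avg_ln 0)"
  proof (rule add_mono)
    show "(\<Sum>k<r - 1. \<Sum>e\<in>E. df k e) \<le> (\<Sum>k<r - 1. num_flags r k * real (card E) * (- real (r - 1) * avg_ln 0))"
    proof (rule sum_mono)
      fix k assume "k \<in> {..<r - 1}"
      then have k: "k < r - 1" "Suc (Suc k) \<le> r" by auto
      have "(\<Sum>e\<in>E. df k e) \<le> num_flags r k * real (card E) * second_diff k"
        unfolding df_def by (rule flag_deviation_le[OF k(2)])
      also have "\<dots> \<le> num_flags r k * real (card E) * (- real (r - 1) * avg_ln 0)"
        using num_flags_pos[OF k(2)] by (intro mult_left_mono second_diff_le[OF k(1)]) simp
      finally show "(\<Sum>e\<in>E. df k e) \<le> \<dots>" .
    qed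
    have "(\<Sum>e\<in>E. ds e) \<le> real r * real (card E) * (avg_ln (r - 1) - avg_ln 0)"
      unfolding ds_def by (rule shadow_deviation_le)
    also have "\<dots> \<le> real r * real (card E) * (- real (r - 1) * avg_ln 0)"
      by (intro mult_left_mono first_diff_le) simp
    finally show "(\<Sum>e\<in>E. ds e) \<le> \<dots>" .
  qed
  also have "\<dots> = real (card E) * deviation_weight r * - ln (rel_codegree {})"
    unfolding deviation_weight_def avg_ln_0[symmetric] sum_distrib_right[symmetric]
    by (simp add: algebra_simps)
  finally show ?thesis .
qed

text \<open>In a regular edge \<open>ln (g C)\<close> differs by at most \<open>4 * s\<close> from
  \<open>ln (g (C \<union> {y})) + ln (g (C \<union> {z})) - ln (g (C \<union> {y, z}))\<close>. Thus the error at most quadruples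
  (up to the additive term, absorbed by the factor 5) whenever the size drops by one.\<close>

lemma abs_ln_rel_codegree_le:
  assumes e: "e \<in> regular_edges s" and s: "s \<le> 1 / 2" and g0: "- ln (rel_codegree {}) \<le> s"
    and A: "A \<subseteq> e" "card A + j = r"
  shows "\<bar>ln (rel_codegree A)\<bar> \<le> 5 * 4 ^ j * s"
  using A
proof (induction j arbitrary: A rule: less_induct)
  case (less j)
  have eE: "e \<in> E" and flag: "\<And>k C y z. k < r - 1 \<Longrightarrow> (C, y, z) \<in> flags k e \<Longrightarrow> \<bar>sqrt (flag_ratio C y z) - 1\<bar> \<le> s"
    and shad: "\<And>A. A \<in> subsets_of_size (r - 1) e \<Longrightarrow> \<bar>sqrt (rel_codegree {} / rel_codegree A) - 1\<bar> \<le> s"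
    using e unfolding regular_edges_def by blast+
  have ecard: "finite e" "card e = r" using finite_edge edge eE by auto
  have g0pos: "0 < rel_codegree {}" using rel_codegree_pos[OF eE] by simp
  have l0: "\<bar>ln (rel_codegree {})\<bar> \<le> s"
    using g0 avg_ln_0_le unfolding avg_ln_0 by linarith
  then have s0: "0 \<le> s" by linarith
  have finA: "finite A" using less.prems ecard finite_subset by blast
  consider "j = 0" | "j = 1" | i where "j = Suc (Suc i)"
    by (metis One_nat_def not0_implies_Suc)
  then show ?case
  proof cases
    case 1
    then have "A = e" using less.prems ecard card_subset_eq[of e A] by simp
    then show ?thesis using s0 by (simp add: rel_codegree_edge[OF eE])
  next
    case 2
    then have "A \<in> subsets_of_size (r - 1) e" using less.prems by (auto simp: subsets_of_size_def)
    moreover have p: "0 < rel_codegree A" using rel_codegree_pos[OF eE] less.prems by simp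
    ultimately have "\<bar>ln (rel_codegree {} / rel_codegree A)\<bar> \<le> 4 * s"
      using g0pos by (intro abs_ln_le_of_sqrt_near_one[OF _ shad s]) auto
    then have "\<bar>ln (rel_codegree {}) - ln (rel_codegree A)\<bar> \<le> 4 * s"
      using g0pos p by (simp add: ln_div)
    then show ?thesis using l0 s0 2 by simp
  next
    case 3
    have "card (e - A) = Suc (Suc i)" using less.prems ecard finA 3 by (simp add: card_Diff_subset)
    then obtain y z where yz: "y \<in> e - A" "z \<in> e - A" "y \<noteq> z"
      by (metis card_Suc_eq insertI1 insertI2)
    have fl: "(A, y, z) \<in> flags (card A) e" using yz less.prems by (auto simp: flags_def subsets_of_size_def)
    have "card A < r - 1" using less.prems 3 by simp
    then have "\<bar>ln (flag_ratio A y z)\<bar> \<le> 4 * s"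
      using fl by (intro abs_ln_le_of_sqrt_near_one[OF flag_ratio_pos[OF eE] flag s])
    then have u: "\<bar>ln (rel_codegree (insert y A)) + ln (rel_codegree (insert z A))
      - ln (rel_codegree (insert y (insert z A))) - ln (rel_codegree A)\<bar> \<le> 4 * s"
      unfolding ln_flag_ratio[OF eE fl] .
    have b1: "\<bar>ln (rel_codegree (insert y A))\<bar> \<le> 5 * 4 ^ Suc i * s"
      using yz less.prems finA 3 by (intro less.IH) auto
    have b2: "\<bar>ln (rel_codegree (insert z A))\<bar> \<le> 5 * 4 ^ Suc i * s"
      using yz less.prems finA 3 by (intro less.IH) auto
    have b3: "\<bar>ln (rel_codegree (insert y (insert z A)))\<bar> \<le> 5 * 4 ^ i * s"
      using yz less.prems finA 3 by (intro less.IH) auto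
    have "4 * s + 2 * (5 * 4 ^ Suc i * s) + 5 * 4 ^ i * s \<le> 5 * 4 ^ j * s"
    proof -
      have "s \<le> s * 4 ^ i" using s0 mult_left_mono[of 1 "4 ^ i" s] by simp
      then show ?thesis using s0 unfolding 3 by simp
    qed
    then show ?thesis using u b1 b2 b3 by linarith
  qed
qed

lemma
  assumes e: "e \<in> regular_edges s" and s: "s \<le> 1 / 2" and g0: "- ln (rel_codegree {}) \<le> s"
    and A: "A \<subseteq> e"
  shows codegree_le_regular: "real (codegree E A) \<le> exp (5 * 4 ^ r * s) * model (card A)"
    and codegree_ge_regular: "exp (- (5 * 4 ^ r * s)) * model (card A) \<le> real (codegree E A)"
proof -
  have eE: "e \<in> E" using e by (simp add: regular_edges_def)
  have c: "card A \<le> r" using card_mono[OF finite_edge[OF eE] A] edge[OF eE] by simp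
  have m: "0 < model (card A)" using model_pos c by blast
  have p: "0 < rel_codegree A" using rel_codegree_pos eE A by blast
  have "\<bar>ln (rel_codegree A)\<bar> \<le> 5 * 4 ^ (r - card A) * s"
    using abs_ln_rel_codegree_le[OF e s g0 A, of "r - card A"] c by simp
  moreover have "5 * 4 ^ (r - card A) * s \<le> 5 * 4 ^ r * s"
  proof -
    have "0 \<le> s" using g0 avg_ln_0_le unfolding avg_ln_0 by linarith
    then show ?thesis by (intro mult_right_mono mult_left_mono power_increasing) auto
  qed
  ultimately have b: "ln (rel_codegree A) \<le> 5 * 4 ^ r * s" "- (5 * 4 ^ r * s) \<le> ln (rel_codegree A)"
    by linarith+
  have d: "real (codegree E A) = rel_codegree A * model (card A)"
    using m by (simp add: rel_codegree_def)
  have "rel_codegree A \<le> exp (5 * 4 ^ r * s)" using b(1) p by (metis exp_le_cancel_iff exp_ln)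
  then show "real (codegree E A) \<le> exp (5 * 4 ^ r * s) * model (card A)"
    unfolding d using m by (intro mult_right_mono) auto
  have "exp (- (5 * 4 ^ r * s)) \<le> rel_codegree A" using b(2) p by (metis exp_le_cancel_iff exp_ln)
  then show "exp (- (5 * 4 ^ r * s)) * model (card A) \<le> real (codegree E A)"
    unfolding d using m by (intro mult_right_mono) auto
qed

end


section \<open>The partition\<close>

text \<open>The proportion of \<open>x ^ r\<close> lost in the three kinds of deletions: irregular edges, edges through
  surplus vertices, and edges through monochromatic pairs. Here \<open>t\<close> bounds the factor by which codegrees
  in regular edges can deviate from \<open>model\<close>.\<close>

definition stability_error :: "nat \<Rightarrow> real \<Rightarrow> real" where
  "stability_error r s = (let t = exp (5 * 4 ^ r * s) in
     s + (t - 1) * t + (t\<^sup>2 - (1 - s) / t\<^sup>2) * t)"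

lemma stability_error_small:
  assumes "0 < \<delta>"
  obtains s where "0 < s" "s \<le> 1 / 2" "stability_error r s \<le> \<delta>"
proof -
  have "(stability_error r \<longlongrightarrow> stability_error r 0) (at_right 0)"
    unfolding stability_error_def Let_def by (intro tendsto_intros) auto
  then have "(stability_error r \<longlongrightarrow> 0) (at_right 0)" by (simp add: stability_error_def)
  then have "eventually (\<lambda>s. stability_error r s < \<delta>) (at_right 0)"
    using assms by (rule order_tendstoD(2))
  moreover have "eventually (\<lambda>s. 0 < s \<and> s \<le> 1 / 2) (at_right (0 :: real))"
    unfolding eventually_at_right_field by (intro exI[of _ "1 / 2"]) auto
  ultimately have "eventually (\<lambda>s. 0 < s \<and> s \<le> 1 / 2 \<and> stability_error r s < \<delta>) (at_right 0)"
    by eventually_elim auto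
  then obtain s where "0 < s" "s \<le> 1 / 2" "stability_error r s < \<delta>"
    using eventually_happens' trivial_limit_at_right_real by blast
  then show ?thesis using that by simp
qed

context shadow_tight_hypergraph
begin

lemma card_E_model: "real (card E) = rel_codegree {} * model 0"
  using model_pos[of 0] by (simp add: rel_codegree_def codegree_empty)

lemma card_E_le_model: "real (card E) \<le> model 0"
  unfolding card_E_model using rel_codegree_empty_le model_pos[of 0]
    mult_right_mono[of "rel_codegree {}" 1 "model 0"] by simp

lemma model_0_mult: "real r * model 0 = x * model 1"
  using partite_codegree_rec[of 0 r l x] r_ge r_le by (simp add: mult.commute)

lemma model_0_mult2: "real (r * (r - 1)) * model 0 = (1 - 1 / real l) * x\<^sup>2 * model 2"
proof -
  have l: "real l > 0" "real (l - 1) = real l - 1" using r_ge r_le by auto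
  have "real (r * (r - 1)) * model 0 = real (r - 1) * (real r * model 0)" by simp
  also have "\<dots> = x * (model 1 * real (r - 1))" unfolding model_0_mult by simp
  also have "model 1 * real (r - 1) = real (l - 1) * (x / real l) * model 2"
    using partite_codegree_rec[of 1 r l x] r_ge r_le by (simp add: numeral_2_eq_2)
  finally show ?thesis unfolding l(2) using l(1) by (simp add: field_simps power2_eq_square)
qed

lemma model_le_power: "k \<le> r \<Longrightarrow> model k \<le> x ^ (r - k)"
proof -
  assume k: "k \<le> r"
  have l: "real l > 0" using r_ge r_le by auto
  have "(l - k) choose (r - k) \<le> (l - k) ^ (r - k)"
    using k r_le by (intro binomial_le_pow) auto
  also have "\<dots> \<le> l ^ (r - k)" by (intro power_mono) auto
  finally have "real (l - k choose (r - k)) \<le> real l ^ (r - k)"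
    by (metis of_nat_le_iff of_nat_power)
  then have "model k \<le> real l ^ (r - k) * (x / real l) ^ (r - k)"
    unfolding partite_codegree_def using x_pos l by (intro mult_right_mono) auto
  also have "\<dots> = x ^ (r - k)" unfolding power_mult_distrib[symmetric] using l by simp
  finally show ?thesis .
qed

text \<open>On the vertices \<open>U\<close> of the regular edges the pairs inside regular edges form a graph whose size
  is close to the Turan bound, because degrees and pair codegrees are nearly those of
  the complete \<open>l\<close>-partite hypergraph. The colouring of \<open>U\<close> given by stability is kept; if \<open>U\<close> is slightly too
  large, arbitrary surplus vertices are dropped, which is cheap since every degree in \<open>U\<close> is bounded.\<close>

lemma near_partite:
  assumes s: "0 < s" "s \<le> 1 / 2" and g0: "- ln (rel_codegree {}) \<le> s"
    and irr: "real (card (E - regular_edges s)) \<le> s * real (card E)"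
  shows "\<exists>V' f. V' \<subseteq> V \<and> int (card V') \<le> \<lceil>x\<rceil> \<and> f ` V' \<subseteq> {1..l} \<and>
    real (card {e\<in>E. \<not> (e \<subseteq> V' \<and> inj_on f e)}) \<le> stability_error r s * x ^ r"
proof -
  define t where "t = exp (5 * 4 ^ r * s)"
  define R where "R = regular_edges s"
  define U where "U = \<Union>R"
  have t1: "1 \<le> t" using s by (simp add: t_def)
  have est: "s \<le> ln t"
  proof -
    have "(1 :: real) \<le> 5 * 4 ^ r" using one_le_power[of "4 :: real" r] by linarith
    then have "1 * s \<le> 5 * 4 ^ r * s" using s by (intro mult_right_mono) auto
    then show ?thesis by (simp add: t_def)
  qed
  have RE: "R \<subseteq> E" by (auto simp: R_def regular_edges_def)
  have finR: "finite R" using RE finite_E finite_subset by blast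
  have UV: "U \<subseteq> V" using RE edge by (auto simp: U_def)
  have finU: "finite U" using UV finite_V finite_subset by blast
  have up: "real (codegree E A) \<le> t * model (card A)"
    and lo: "model (card A) / t \<le> real (codegree E A)" if "e \<in> R" "A \<subseteq> e" for e A
    using codegree_le_regular[OF _ s(2) g0 that(2)] codegree_ge_regular[OF _ s(2) g0 that(2)] that(1)
    by (auto simp: R_def t_def exp_minus field_simps)
  have m1: "0 < model 0" "0 < model 1" "0 < model 2" using model_pos r_ge by auto
  have g0pos: "0 < rel_codegree {}" using nonempty rel_codegree_pos by blast
  have g0t: "1 / t \<le> rel_codegree {}"
  proof -
    have "ln (1 / t) \<le> ln (rel_codegree {})"
      using g0 est t1 by (simp add: ln_div)
    then show ?thesis using g0pos t1 by simp
  qed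

  \<comment> \<open>The degrees sum to \<open>r * card E\<close>, which is at most \<open>r * model 0 = x * model 1\<close>.\<close>
  have cardU: "real (card U) \<le> x * t"
  proof -
    have "real (card U) * (model 1 / t) \<le> (\<Sum>v\<in>U. real (codegree E {v}))"
    proof (rule sum_bounded_below)
      fix v assume "v \<in> U"
      then obtain e where "e \<in> R" "v \<in> e" by (auto simp: U_def)
      then show "model 1 / t \<le> real (codegree E {v})" using lo[of e "{v}"] by simp
    qed
    also have "\<dots> \<le> (\<Sum>v\<in>V. real (codegree E {v}))"
      using finite_V UV by (intro sum_mono2) auto
    also have "\<dots> = real r * real (card E)"
      using sum_codegree_insert[of "{}" 0] by (simp add: codegree_empty flip: of_nat_sum of_nat_mult)
    also have "\<dots> \<le> real r * model 0" by (intro mult_left_mono card_E_le_model) simp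
    finally have "real (card U) * (model 1 / t) \<le> x * model 1" unfolding model_0_mult .
    then show ?thesis using m1 t1 by (simp add: field_simps)
  qed

  define rel where "rel y z \<longleftrightarrow> y \<noteq> z \<and> (\<exists>e\<in>R. {y, z} \<subseteq> e)" for y z
  define P where "P = {(y, z) \<in> U \<times> U. rel y z}"
  have finP: "finite P" using finU by (auto simp: P_def intro: finite_subset[of _ "U \<times> U"])
  have pair_up: "real (codegree E {y, z}) \<le> t * model 2" if "(y, z) \<in> P" for y z
  proof -
    from that obtain e where "y \<noteq> z" "e \<in> R" "{y, z} \<subseteq> e" by (auto simp: P_def rel_def)
    then show ?thesis using up[of e "{y, z}"] by (simp add: numeral_2_eq_2)
  qed
  \<comment> \<open>Regular edges contain \<open>r * (r - 1)\<close> ordered pairs each, and no pair is in too many edges.\<close>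
  have cardP: "(1 - s) / t\<^sup>2 * ((1 - 1 / real l) * x\<^sup>2) \<le> real (card P)"
  proof -
    have "(\<Sum>p\<in>P. card {e\<in>R. case p of (y, z) \<Rightarrow> {y, z} \<subseteq> e}) = (r * (r - 1)) * card R"
    proof (rule sum_multicount[OF finP finR], rule ballI)
      fix e assume e: "e \<in> R"
      then have ec: "finite e" "card e = r" using RE finite_edge edge by auto
      have "{p \<in> P. case p of (y, z) \<Rightarrow> {y, z} \<subseteq> e} = (SIGMA y:e. e - {y})"
        using e by (auto simp: P_def rel_def U_def)
      also have "card \<dots> = r * (r - 1)" using ec by simp
      finally show "card {p \<in> P. case p of (y, z) \<Rightarrow> {y, z} \<subseteq> e} = r * (r - 1)" .
    qed
    then have "real (r * (r - 1) * card R) = real (\<Sum>p\<in>P. card {e\<in>R. case p of (y, z) \<Rightarrow> {y, z} \<subseteq> e})"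
      by (simp only:)
    then have "real (r * (r - 1)) * real (card R) = (\<Sum>p\<in>P. real (card {e\<in>R. case p of (y, z) \<Rightarrow> {y, z} \<subseteq> e}))"
      by (simp only: of_nat_sum of_nat_mult)
    also have "\<dots> \<le> real (card P) * (t * model 2)"
    proof (rule sum_bounded_above)
      fix p assume p: "p \<in> P"
      obtain y z where yz: "p = (y, z)" by (cases p)
      have "card {e\<in>R. {y, z} \<subseteq> e} \<le> codegree E {y, z}"
        unfolding codegree_def using RE finite_E by (intro card_mono) auto
      then show "real (card {e\<in>R. case p of (y, z) \<Rightarrow> {y, z} \<subseteq> e}) \<le> t * model 2"
        using pair_up[of y z] p unfolding yz by simp
    qed
    finally have 1: "real (r * (r - 1)) * real (card R) \<le> real (card P) * (t * model 2)" .
    have "card (E - R) = card E - card R" using RE finR by (intro card_Diff_subset) auto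
    moreover have "card R \<le> card E" using RE finite_E by (intro card_mono) auto
    ultimately have "(1 - s) * real (card E) \<le> real (card R)"
      using irr by (simp add: R_def algebra_simps of_nat_diff)
    moreover have "(1 - s) * (model 0 / t) \<le> (1 - s) * real (card E)"
      unfolding card_E_model using g0t m1 s mult_right_mono[OF g0t, of "model 0"]
      by (intro mult_left_mono) auto
    ultimately have "(1 - s) * (model 0 / t) \<le> real (card R)" by linarith
    then have "real (r * (r - 1)) * ((1 - s) * (model 0 / t)) \<le> real (r * (r - 1)) * real (card R)"
      by (intro mult_left_mono) auto
    also have "real (r * (r - 1)) * ((1 - s) * (model 0 / t)) = (1 - s) / t * (real (r * (r - 1)) * model 0)"
      by simp
    also note 1
    finally have "(1 - s) / t * ((1 - 1 / real l) * x\<^sup>2) * model 2 \<le> real (card P) * t * model 2"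
      unfolding model_0_mult2 by (simp add: mult_ac)
    then have "(1 - s) / t * ((1 - 1 / real l) * x\<^sup>2) \<le> real (card P) * t"
      by (rule mult_right_le_imp_le) (use m1 in simp)
    moreover have "a / t\<^sup>2 * q \<le> p" if "a / t * q \<le> p * t" for a p q
      using that t1 by (simp add: field_simps power2_eq_square)
    ultimately show ?thesis by blast
  qed

  have "\<exists>f :: 'a \<Rightarrow> nat. f ` U \<subseteq> {1..l} \<and>
    (\<Sum>x\<in>U. \<Sum>y\<in>U. of_bool (rel x y) * 1 * 1) + (\<Sum>x\<in>U. \<Sum>y\<in>U. of_bool (rel x y \<and> f x = f y) * 1 * 1)
      \<le> (\<Sum>x\<in>U. \<Sum>y\<in>U. of_bool (f x \<noteq> f y) * 1 * (1 :: real))"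
  proof (rule coloring_of_clique_free_relation[OF finU])
    show "rel v u" if "rel u v" for u v using that by (auto simp: rel_def insert_commute)
    show "\<not> rel v v" for v by (simp add: rel_def)
    fix S assume S: "S \<subseteq> U" "card S = Suc l"
    then obtain u v where "u \<in> S" "v \<in> S" "u \<noteq> v" "\<not> (\<exists>e\<in>E. {u, v} \<subseteq> e)"
      using uncovered_pair[of S] UV by blast
    then show "\<exists>u\<in>S. \<exists>v\<in>S. u \<noteq> v \<and> \<not> rel u v" using RE by (auto simp: rel_def)
  qed simp
  then obtain f :: "'a \<Rightarrow> nat" where f: "f ` U \<subseteq> {1..l}" and fle:
    "(\<Sum>x\<in>U. \<Sum>y\<in>U. of_bool (rel x y) * 1 * 1) + (\<Sum>x\<in>U. \<Sum>y\<in>U. of_bool (rel x y \<and> f x = f y) * 1 * 1)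
      \<le> (\<Sum>x\<in>U. \<Sum>y\<in>U. of_bool (f x \<noteq> f y) * 1 * (1 :: real))" by blast
  have lpos: "0 < l" using r_ge r_le by simp
  have sum_pairs: "(\<Sum>x\<in>U. \<Sum>y\<in>U. of_bool (Q x y) * 1 * (1 :: real)) = real (card {(y, z) \<in> U \<times> U. Q y z})"
    for Q :: "'a \<Rightarrow> 'a \<Rightarrow> bool"
  proof -
    have "(\<Sum>x\<in>U. \<Sum>y\<in>U. of_bool (Q x y) * 1 * (1 :: real)) = (\<Sum>p\<in>U \<times> U. of_bool (case p of (y, z) \<Rightarrow> Q y z))"
      by (simp add: sum.cartesian_product case_prod_unfold)
    also have "\<dots> = (\<Sum>p\<in>{(y, z) \<in> U \<times> U. Q y z}. 1)"
      by (rule sum.mono_neutral_cong_right) (use finU in auto)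
    finally show ?thesis by simp
  qed
  define I where "I = {(y, z) \<in> U \<times> U. rel y z \<and> f y = f z}"
  have finI: "finite I" and IP: "I \<subseteq> P" using finP by (auto simp: I_def P_def intro: finite_subset[of _ P])
  have cardI: "real (card I) \<le> x\<^sup>2 * (t\<^sup>2 - (1 - s) / t\<^sup>2)"
  proof -
    have "real (card P) + real (card I) \<le> (1 - 1 / real l) * (\<Sum>v\<in>U. 1)\<^sup>2"
      using fle cross_weight_le[OF finU f lpos, of "\<lambda>_. 1"] unfolding sum_pairs P_def I_def by linarith
    also have "\<dots> \<le> (1 - 1 / real l) * (x * t)\<^sup>2"
      using cardU lpos by (intro mult_left_mono power_mono) auto
    finally have *: "real (card P) + real (card I) \<le> (1 - 1 / real l) * (x\<^sup>2 * t\<^sup>2)"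
      by (simp only: power_mult_distrib)
    have "i \<le> q * (X * (u - b))" if "p + i \<le> q * (X * u)" "b * (q * X) \<le> p" for i q X u b p :: real
      using that by (simp add: algebra_simps)
    from this[OF * cardP] have "real (card I) \<le> (1 - 1 / real l) * (x\<^sup>2 * (t\<^sup>2 - (1 - s) / t\<^sup>2))" .
    also have "\<dots> \<le> 1 * (x\<^sup>2 * (t\<^sup>2 - (1 - s) / t\<^sup>2))"
    proof (rule mult_right_mono)
      have "1 \<le> t\<^sup>2" using t1 by simp
      then have "(1 - s) / t\<^sup>2 \<le> t\<^sup>2" using s divide_le_eq_1_pos[of "t\<^sup>2" "1 - s"] by linarith
      then show "0 \<le> x\<^sup>2 * (t\<^sup>2 - (1 - s) / t\<^sup>2)" by simp
    qed simp
    finally show ?thesis by simp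
  qed

  have "\<exists>V'\<subseteq>U. int (card V') \<le> \<lceil>x\<rceil> \<and> real (card (U - V')) \<le> x * (t - 1)"
  proof (cases "int (card U) \<le> \<lceil>x\<rceil>")
    case True
    then show ?thesis using x_pos t1 by (intro exI[of _ U]) auto
  next
    case False
    have c0: "0 \<le> \<lceil>x\<rceil>" using x_pos by simp
    then have "nat \<lceil>x\<rceil> \<le> card U" using False by linarith
    then obtain V' where V': "V' \<subseteq> U" "card V' = nat \<lceil>x\<rceil>" using obtain_subset_with_card_n by metis
    have "finite V'" using V' finU finite_subset by blast
    then have "real (card (U - V')) = real (card U) - real (card V')"
      using V'(1) card_mono[OF finU V'(1)] by (simp only: card_Diff_subset of_nat_diff)
    also have "\<dots> \<le> x * t - x"
    proof -
      have "x \<le> real (card V')" using V'(2) c0 by (simp add: le_of_int_ceiling)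
      then show ?thesis using cardU by linarith
    qed
    finally show ?thesis using V' c0 by (intro exI[of _ V']) (auto simp: algebra_simps)
  qed
  then obtain V' where V': "V' \<subseteq> U" "int (card V') \<le> \<lceil>x\<rceil>" "real (card (U - V')) \<le> x * (t - 1)" by blast

  have "{e\<in>E. \<not> (e \<subseteq> V' \<and> inj_on f e)} \<subseteq>
     (E - R) \<union> (\<Union>v\<in>U - V'. {e\<in>E. {v} \<subseteq> e}) \<union> (\<Union>p\<in>I. {e\<in>E. {fst p, snd p} \<subseteq> e})"
  proof
    fix e assume e: "e \<in> {e\<in>E. \<not> (e \<subseteq> V' \<and> inj_on f e)}"
    show "e \<in> (E - R) \<union> (\<Union>v\<in>U - V'. {e\<in>E. {v} \<subseteq> e}) \<union> (\<Union>p\<in>I. {e\<in>E. {fst p, snd p} \<subseteq> e})"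
    proof (cases "e \<in> R")
      case False then show ?thesis using e by blast
    next
      case True
      then have eU: "e \<subseteq> U" by (auto simp: U_def)
      show ?thesis
      proof (cases "e \<subseteq> V'")
        case False then show ?thesis using e eU by blast
      next
        case True
        then obtain y z where yz: "y \<in> e" "z \<in> e" "y \<noteq> z" "f y = f z" using e by (auto simp: inj_on_def)
        then have "(y, z) \<in> I" using eU \<open>e \<in> R\<close> by (auto simp: I_def rel_def)
        then show ?thesis using e yz by force
      qed
    qed
  qed
  then have "card {e\<in>E. \<not> (e \<subseteq> V' \<and> inj_on f e)} \<le>
     card ((E - R) \<union> (\<Union>v\<in>U - V'. {e\<in>E. {v} \<subseteq> e}) \<union> (\<Union>p\<in>I. {e\<in>E. {fst p, snd p} \<subseteq> e}))"
    using finite_E finU finI by (intro card_mono) auto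
  also have "\<dots> \<le> card (E - R) + card (\<Union>v\<in>U - V'. {e\<in>E. {v} \<subseteq> e}) + card (\<Union>p\<in>I. {e\<in>E. {fst p, snd p} \<subseteq> e})"
    using card_Un_le by (meson add_le_mono1 le_trans)
  also have "\<dots> \<le> card (E - R) + (\<Sum>v\<in>U - V'. codegree E {v}) + (\<Sum>p\<in>I. codegree E {fst p, snd p})"
    unfolding codegree_def using finU finI by (intro add_mono card_UN_le) auto
  finally have "real (card {e\<in>E. \<not> (e \<subseteq> V' \<and> inj_on f e)}) \<le>
      real (card (E - R)) + (\<Sum>v\<in>U - V'. real (codegree E {v})) + (\<Sum>p\<in>I. real (codegree E {fst p, snd p}))"
    unfolding of_nat_le_iff[where ?'a = real, symmetric] by simp
  also have "\<dots> \<le> s * x ^ r + real (card (U - V')) * (t * model 1) + real (card I) * (t * model 2)"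
  proof (intro add_mono sum_bounded_above)
    have "real (card E) \<le> x ^ r" using card_E_le_model model_le_power[of 0] by simp
    then have "s * real (card E) \<le> s * x ^ r" using s by (intro mult_left_mono) auto
    then show "real (card (E - R)) \<le> s * x ^ r" using irr by (simp add: R_def)
  next
    fix v assume "v \<in> U - V'"
    then obtain e where "e \<in> R" "v \<in> e" by (auto simp: U_def)
    then show "real (codegree E {v}) \<le> t * model 1" using up[of e "{v}"] by simp
  next
    fix p assume "p \<in> I"
    then show "real (codegree E {fst p, snd p}) \<le> t * model 2" using pair_up[of "fst p" "snd p"] IP by auto
  qed
  also have "\<dots> \<le> s * x ^ r + (x * (t - 1)) * (t * x ^ (r - 1)) + (x\<^sup>2 * (t\<^sup>2 - (1 - s) / t\<^sup>2)) * (t * x ^ (r - 2))"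
  proof -
    have "t * model 1 \<le> t * x ^ (r - 1)" "t * model 2 \<le> t * x ^ (r - 2)"
      using model_le_power[of 1] model_le_power[of 2] r_ge t1 by (auto intro!: mult_left_mono)
    moreover have "0 \<le> x * (t - 1)" "0 \<le> x\<^sup>2 * (t\<^sup>2 - (1 - s) / t\<^sup>2)"
      using x_pos t1 cardI order_trans[OF of_nat_0_le_iff cardI] by auto
    ultimately show ?thesis using V'(3) cardI m1 t1
      by (intro add_mono mult_mono order_refl) auto
  qed
  also have "\<dots> = stability_error r s * x ^ r"
  proof -
    have "1 + (r - 1) = r" "2 + (r - 2) = r" using r_ge by linarith+
    then have p: "x * x ^ (r - 1) = x ^ r" "x\<^sup>2 * x ^ (r - 2) = x ^ r"
      by (metis power_add power_one_right)+
    have "s * x ^ r + (x * (t - 1)) * (t * x ^ (r - 1)) + (x\<^sup>2 * (t\<^sup>2 - (1 - s) / t\<^sup>2)) * (t * x ^ (r - 2))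
      = s * x ^ r + (t - 1) * t * (x * x ^ (r - 1)) + (t\<^sup>2 - (1 - s) / t\<^sup>2) * t * (x\<^sup>2 * x ^ (r - 2))"
      by (simp only: mult_ac)
    then show ?thesis unfolding p stability_error_def Let_def t_def[symmetric] by (simp only: distrib_right)
  qed
  finally have "real (card {e\<in>E. \<not> (e \<subseteq> V' \<and> inj_on f e)}) \<le> stability_error r s * x ^ r" .
  moreover have "V' \<subseteq> V" "f ` V' \<subseteq> {1..l}" using V' UV f by auto
  ultimately show ?thesis using V'(2) by blast
qed

end

text \<open>Choosing one covering edge for each pair of a pairwise covered \<open>k\<close>-set gives a subgraph with at
  most \<open>k choose 2\<close> edges; renaming its vertices by natural numbers yields a member of the family.\<close>

lemma uncovered_pair_of_family_free:
  fixes H :: "'a hypergraph"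
  assumes H: "r_graph r H" and free: "family_free (K_family r k) H"
    and S: "S \<subseteq> verts H" "card S = k"
  shows "\<exists>u\<in>S. \<exists>v\<in>S. u \<noteq> v \<and> \<not> (\<exists>e\<in>edges H. {u, v} \<subseteq> e)"
proof (rule ccontr)
  assume "\<not> ?thesis"
  then have cov: "\<exists>e\<in>edges H. {u, v} \<subseteq> e" if "u \<in> S" "v \<in> S" "u \<noteq> v" for u v
    using that by blast
  have finV: "finite (verts H)" using H by (simp add: r_graph_def)
  have finS: "finite S" using S finV finite_subset by blast
  define pairs where "pairs = subsets_of_size 2 S"
  have "\<exists>e\<in>edges H. p \<subseteq> e" if "p \<in> pairs" for p
  proof -
    from that obtain u v where "p = {u, v}" "u \<noteq> v" "p \<subseteq> S"
      by (auto simp: pairs_def subsets_of_size_def card_2_iff)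
    then show ?thesis using cov[of u v] by auto
  qed
  then obtain c where c: "\<And>p. p \<in> pairs \<Longrightarrow> c p \<in> edges H \<and> p \<subseteq> c p" by metis
  obtain h :: "'a \<Rightarrow> nat" where h: "inj_on h (verts H)"
    using finite_imp_inj_to_nat_seg[OF finV] by metis
  define F where "F = \<lparr>verts = h ` verts H, edges = (\<lambda>p. h ` c p) ` pairs\<rparr>"
  have cV: "c p \<subseteq> verts H" "card (c p) = r" if "p \<in> pairs" for p
    using c[OF that] H by (auto simp: r_graph_def)
  have finp: "finite pairs" using finS by (simp add: pairs_def)
  have "card (edges F) \<le> k choose 2"
    using card_image_le[OF finp, of "\<lambda>p. h ` c p"] card_subsets_of_size[OF finS, of 2] S(2)
    by (simp add: F_def pairs_def)
  moreover have "r_graph r F"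
    unfolding r_graph_def F_def using finV cV h by (auto simp: card_image inj_on_subset)
  moreover have "\<exists>e\<in>edges F. {h u, h v} \<subseteq> e" if "u \<in> S" "v \<in> S" "u \<noteq> v" for u v
  proof -
    have "{u, v} \<in> pairs" using that by (auto simp: pairs_def subsets_of_size_def)
    then show ?thesis using c[of "{u, v}"] by (auto simp: F_def)
  qed
  moreover have "h ` S \<subseteq> verts F" "card (h ` S) = k"
    using S h by (auto simp: F_def card_image inj_on_subset)
  ultimately have "F \<in> K_family r k"
    unfolding K_family_def by (auto intro!: exI[of _ "h ` S"])
  moreover have "contains_copy H F"
  proof -
    let ?g = "inv_into (verts H) h"
    have "?g ` (h ` A) = A" if "A \<subseteq> verts H" for A using h that by (simp add: inv_into_image_cancel)
    then show ?thesis unfolding contains_copy_def F_def using c cV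
      by (intro exI[of _ ?g]) (auto simp: inj_on_inv_into)
  qed
  ultimately show False using free by (auto simp: family_free_def)
qed

theorem theorem1p7:
  fixes l r :: nat and \<delta> :: real
  assumes "2 \<le> r" and "r \<le> l" and "\<delta> > 0"
  shows "\<exists>(\<epsilon>::real) (n\<^sub>0::nat). \<epsilon> > 0 \<and>
    (\<forall>(x::real) (H :: 'a hypergraph).
       x \<ge> real n\<^sub>0 \<longrightarrow>
       r_graph r H \<longrightarrow>
       family_free (K_family r (l + 1)) H \<longrightarrow>
       real (card (edges (shadow r H))) = real (l choose (r - 1)) * (x / real l) ^ (r - 1) \<longrightarrow>
       real (card (edges H)) \<ge> (1 - \<epsilon>) * real (l choose r) * (x / real l) ^ r \<longrightarrow>
       (\<exists>V' \<subseteq> verts H. int (card V') \<le> \<lceil>x\<rceil> \<and>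
          (\<exists>K D. complete_partite r l V' K \<and>
             D \<subseteq> edges H \<and> real (card D) \<le> \<delta> * x ^ r \<and>
             edges H - D \<subseteq> edges K)))"
proof -
  obtain s where s: "0 < s" "s \<le> 1 / 2" "stability_error r s \<le> \<delta>"
    using stability_error_small assms(3) by blast
  define T where "T = deviation_weight r"
  have T: "0 < T" using deviation_weight_pos assms(1) by (simp add: T_def)
  \<comment> \<open>The cube leaves a proportion \<open>s\<close> of irregular edges after division by \<open>s\<^sup>2\<close>.\<close>
  define \<eta> where "\<eta> = min s (s ^ 3 / T)"
  have \<eta>: "0 < \<eta>" "\<eta> \<le> s" "T * \<eta> \<le> s ^ 3"
    using s T by (auto simp: \<eta>_def min_def field_simps)
  define \<epsilon> where "\<epsilon> = 1 - exp (- \<eta>)"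
  have "\<epsilon> > 0" using \<eta> by (simp add: \<epsilon>_def)
  moreover have "\<exists>V' \<subseteq> verts H. int (card V') \<le> \<lceil>x\<rceil> \<and>
          (\<exists>K D. complete_partite r l V' K \<and>
             D \<subseteq> edges H \<and> real (card D) \<le> \<delta> * x ^ r \<and>
             edges H - D \<subseteq> edges K)"
    if x: "x \<ge> real 1" and H: "r_graph r H" and free: "family_free (K_family r (l + 1)) H"
      and shadow: "real (card (edges (shadow r H))) = real (l choose (r - 1)) * (x / real l) ^ (r - 1)"
      and large: "real (card (edges H)) \<ge> (1 - \<epsilon>) * real (l choose r) * (x / real l) ^ r"
    for x :: real and H :: "'a hypergraph"
  proof -
    have pos: "0 < real (l choose r) * (x / real l) ^ r"
      using x assms by (auto simp: zero_less_binomial_iff intro!: mult_pos_pos)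
    have large': "exp (- \<eta>) * (real (l choose r) * (x / real l) ^ r) \<le> real (card (edges H))"
      using large by (simp add: \<epsilon>_def mult.assoc)
    moreover have "0 < exp (- \<eta>) * (real (l choose r) * (x / real l) ^ r)" using pos by simp
    ultimately have "0 < real (card (edges H))" by linarith
    then have ne: "edges H \<noteq> {}" by auto
    interpret shadow_tight_hypergraph "verts H" "edges H" r l x
    proof
      show "finite (verts H)" using H by (simp add: r_graph_def)
      show "e \<subseteq> verts H \<and> card e = r" if "e \<in> edges H" for e using H that by (simp add: r_graph_def)
      show "\<exists>u\<in>S. \<exists>v\<in>S. u \<noteq> v \<and> \<not> (\<exists>e\<in>edges H. {u, v} \<subseteq> e)"
        if "S \<subseteq> verts H" "card S = Suc l" for S
        using uncovered_pair_of_family_free[OF H free] that by simp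
    qed (use assms x ne shadow in \<open>auto simp: shadow_def\<close>)
    have "exp (- \<eta>) \<le> rel_codegree {}"
      using large' pos model_pos[of 0]
      by (simp add: rel_codegree_def codegree_empty partite_codegree_def pos_le_divide_eq)
    then have lg: "- ln (rel_codegree {}) \<le> \<eta>"
      by (metis exp_gt_zero ln_exp ln_le_cancel_iff minus_le_iff order_less_le_trans)
    have "real (card (edges H - regular_edges s)) * s\<^sup>2 \<le> real (card (edges H)) * T * - ln (rel_codegree {})"
      unfolding T_def using s by (intro irregular_edges_le) simp
    also have "\<dots> \<le> real (card (edges H)) * T * \<eta>" using T lg by (intro mult_left_mono) auto
    also have "\<dots> \<le> real (card (edges H)) * s ^ 3" using \<eta>(3) by (simp add: mult.assoc mult_left_mono)
    also have "\<dots> = (s * real (card (edges H))) * s\<^sup>2" by (simp add: power2_eq_square power3_eq_cube)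
    finally have irr: "real (card (edges H - regular_edges s)) \<le> s * real (card (edges H))"
      using s by simp
    obtain V' f where V': "V' \<subseteq> verts H" "int (card V') \<le> \<lceil>x\<rceil>" "f ` V' \<subseteq> {1..l}"
      and D: "real (card {e\<in>edges H. \<not> (e \<subseteq> V' \<and> inj_on f e)}) \<le> stability_error r s * x ^ r"
      using near_partite[OF s(1,2) _ irr] lg \<eta>(2) by force
    define W where "W i = {v\<in>V'. f v = i}" for i
    define K where "K = \<lparr>verts = V', edges = {e. e \<subseteq> V' \<and> card e = r \<and> (\<forall>i \<in> {1..l}. card (e \<inter> W i) \<le> 1)}\<rparr>"
    have "complete_partite r l V' K"
      unfolding complete_partite_def K_def
      by (rule exI[of _ W]) (use V'(3) in \<open>auto simp: W_def disjoint_family_on_def\<close>)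
    moreover have "e \<in> edges K" if e: "e \<in> edges H" "e \<subseteq> V'" "inj_on f e" for e
    proof -
      have "card (e \<inter> W i) \<le> 1" for i
        using e(3) finite_edge[OF e(1)] by (auto simp: card_le_Suc0_iff_eq W_def dest: inj_onD)
      then show ?thesis using e edge by (simp add: K_def)
    qed
    moreover have "stability_error r s * x ^ r \<le> \<delta> * x ^ r"
      using s(3) x by (intro mult_right_mono) auto
    ultimately show ?thesis using V' D
      by (intro exI[of _ V'] conjI exI[of _ K] exI[of _ "{e\<in>edges H. \<not> (e \<subseteq> V' \<and> inj_on f e)}"]) auto
  qed
  ultimately show ?thesis by blast
qed

end
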